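(* Suppose $W,U\in\mathcal{DT}$ are operators of diagonal type on $L^2(\mathbb T)$ and $U$ is unitary. Then $$\mathbf T(WU)=\mathbf T(W)=\mathbf T(UW).$$
   Context: $\mathbb T=\mathbb R/(2\pi\mathbb Z)$ with measure $\frac1{2\pi}dx$. An operator $W$ on $L^2(\mathbb T)$ is described by its matrix $(W_{j,k})_{j,k\in\mathbb Z}$ in the basis $e^{ikx}$: if $f=\sum_kf_ke^{ikx}$ then $Wf=\sum_{j}\big(\sum_kW_{j,k}f_k\big)e^{ijx}$. Put $c_k=\sup_{j\in\mathbb Z}|W_{k+j,j}|$. $W$ is of diagonal type, $W\in\mathcal{DT}$, if $\sum_{k\in\mathbb Z}c_k<\infty$ (products of operators in $\mathcal{DT}$ are again in $\mathcal{DT}$). For $W\in\mathcal{DT}$ define $\mathbf T(W)=\limsup_{\#I\to\infty}\frac1{\#I}\sum_{j\in\mathbb Z,\,l\in I}|W_{l,j}|^2$, where $I=\{n,n+1,\dots,m\}\subset\mathbb Z$ ranges over finite integer intervals, $\#I=m-n+1$, and $\limsup_{\#I\to\infty}$ means $\lim_{N\to\infty}\sup_{\#I\ge N}$. *)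

theory Defs
  imports "HOL-Analysis.Analysis"
begin

text \<open>
  The circle is represented by its fundamental domain: \<open>circle\<close> is \<open>dx / (2 pi)\<close> on
  \<open>[0, 2 pi)\<close>, extended by zero to the real line. Elements of the Hilbert space are
  represented by square-integrable functions, with equality almost everywhere in place of equality.
\<close>

definition circle :: "real measure" where
  "circle = uniform_measure lborel {0..<2 * pi}"

definition L2 :: "(real \<Rightarrow> complex) set" where
  "L2 = {f \<in> borel_measurable circle. integrable circle (\<lambda>x. (cmod (f x))\<^sup>2)}"

definition L2_eq :: "(real \<Rightarrow> complex) \<Rightarrow> (real \<Rightarrow> complex) \<Rightarrow> bool" (infix "\<doteq>" 50) where
  "f \<doteq> g \<longleftrightarrow> (AE x in circle. f x = g x)"

definition L2_inner :: "(real \<Rightarrow> complex) \<Rightarrow> (real \<Rightarrow> complex) \<Rightarrow> complex" where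
  "L2_inner f g = (LINT x|circle. f x * cnj (g x))"

definition L2_norm :: "(real \<Rightarrow> complex) \<Rightarrow> real" where
  "L2_norm f = sqrt (LINT x|circle. (cmod (f x))\<^sup>2)"

definition fourier_basis :: "int \<Rightarrow> real \<Rightarrow> complex" where
  "fourier_basis k x = exp (\<i> * of_int k * of_real x)"

type_synonym L2_map = "(real \<Rightarrow> complex) \<Rightarrow> (real \<Rightarrow> complex)"

text \<open>Bounded complex-linear operators. Maps are unconstrained outside \<open>L2\<close>.\<close>

definition L2_operator :: "L2_map \<Rightarrow> bool" where
  "L2_operator W \<longleftrightarrow>
     (\<forall>f\<in>L2. W f \<in> L2) \<and>
     (\<forall>f\<in>L2. \<forall>g\<in>L2. f \<doteq> g \<longrightarrow> W f \<doteq> W g) \<and>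
     (\<forall>f\<in>L2. \<forall>g\<in>L2. W (\<lambda>x. f x + g x) \<doteq> (\<lambda>x. W f x + W g x)) \<and>
     (\<forall>a. \<forall>f\<in>L2. W (\<lambda>x. a * f x) \<doteq> (\<lambda>x. a * W f x)) \<and>
     (\<exists>C. \<forall>f\<in>L2. L2_norm (W f) \<le> C * L2_norm f)"

definition unitary_operator :: "L2_map \<Rightarrow> bool" where
  "unitary_operator U \<longleftrightarrow> L2_operator U \<and>
     (\<forall>f\<in>L2. \<forall>g\<in>L2. L2_inner (U f) (U g) = L2_inner f g) \<and>
     (\<forall>g\<in>L2. \<exists>f\<in>L2. U f \<doteq> g)"

text \<open>
  The entry in row \<open>j\<close>, column \<open>k\<close> is the \<open>j\<close>-th Fourier coefficient of the image of the
  \<open>k\<close>-th basis vector.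
\<close>

definition matrix_entry :: "L2_map \<Rightarrow> int \<Rightarrow> int \<Rightarrow> complex" where
  "matrix_entry W j k = L2_inner (W (fourier_basis k)) (fourier_basis j)"

text \<open>
  Suprema, infinite sums and limits below are taken in \<open>[0, \<infinity>]\<close>, so that they
  always have their intended value and no summability side condition is hidden.
\<close>

definition diag_sup :: "L2_map \<Rightarrow> int \<Rightarrow> ennreal" where
  "diag_sup W k = (SUP j. ennreal (cmod (matrix_entry W (k + j) j)))"

definition diagonal_type :: "L2_map set" where
  "diagonal_type = {W. L2_operator W \<and> (\<Sum>\<^sub>\<infinity>k\<in>UNIV. diag_sup W k) < \<infinity>}"

definition interval_mean :: "L2_map \<Rightarrow> int \<Rightarrow> int \<Rightarrow> ennreal" where
  "interval_mean W n m =
     (\<Sum>\<^sub>\<infinity>(j, l)\<in>UNIV \<times> {n..m}. ennreal ((cmod (matrix_entry W l j))\<^sup>2))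
       / of_nat (card {n..m})"

text \<open>The suprema decrease in \<open>N\<close>, so the limit exists.\<close>

definition mean_limsup :: "L2_map \<Rightarrow> ennreal" where
  "mean_limsup W =
     lim (\<lambda>N. SUP (n, m) \<in> {(n, m). n \<le> m \<and> N \<le> card {n..m}}. interval_mean W n m)"

end

theory Submission
  imports Defs
begin

text \<open>
  The sum of \<open>|\<phi> b|\<^sup>2\<close> over an orthonormal basis is the squared norm of the bounded
  functional \<open>\<phi>\<close>, hence independent of the basis. For \<open>\<phi> f = \<langle>W f, e\<^sub>l\<rangle>\<close> and the bases
  \<open>e\<^sub>j\<close> and \<open>U e\<^sub>j\<close> this shows that \<open>W U\<close> and \<open>W\<close> have the same row sums of squared
  entries, so even their means over each interval coincide. For \<open>U W\<close> it is the column sums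
  \<open>\<parallel>U W e\<^sub>j\<parallel>\<^sup>2 = \<parallel>W e\<^sub>j\<parallel>\<^sup>2\<close> that agree with those of \<open>W\<close>. For an operator of diagonal type, summing
  over the rows in \<open>I\<close> instead of the columns in \<open>I\<close> only affects entries with exactly one index
  in \<open>I\<close>; these contribute at most \<open>\<Sum>\<^sub>k c\<^sub>k\<^sup>2 min(|k|, #I) = o(#I)\<close>, so the limits agree.
\<close>

section \<open>The Hilbert space of square-integrable functions\<close>

lemma sets_circle [measurable_cong]: "sets circle = sets borel"
  by (simp add: circle_def)

lemma space_circle [simp]: "space circle = UNIV"
  by (simp add: circle_def)

lemma emeasure_circle: "emeasure circle UNIV = 1"
  using emeasure_uniform_measure[of "{0..<2 * pi}" lborel UNIV]
  by (simp add: circle_def ennreal_divide_self)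

interpretation circle: finite_measure circle
  by standard (simp add: emeasure_circle)

lemma borel_measurable_cnj [measurable]: "cnj \<in> borel_measurable borel"
  by (intro borel_measurable_continuous_onI continuous_intros)

lemma AE_circle_I: "(\<And>x. 0 \<le> x \<Longrightarrow> x < 2 * pi \<Longrightarrow> P x) \<Longrightarrow> AE x in circle. P x"
  unfolding circle_def by (rule AE_uniform_measureI) auto

text \<open>Up to a conversion of the density to real values this is the definition of
  \<open>uniform_measure\<close>. The integral becomes a set integral over \<open>lborel\<close>, to
  which the fundamental theorem of calculus applies.\<close>

lemma integral_circle:
  fixes f :: "real \<Rightarrow> complex"
  assumes [measurable]: "f \<in> borel_measurable borel"
  shows "(LINT x|circle. f x) = (LINT x:{0..<2 * pi}|lborel. f x) / (2 * pi)"
proof -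
  have "circle = density lborel (\<lambda>x. ennreal (indicator {0..<2 * pi} x / (2 * pi)))"
    unfolding circle_def uniform_measure_def
    by (intro arg_cong[of _ _ "density lborel"] ext)
       (auto simp: indicator_def divide_ennreal simp flip: ennreal_1)
  then have "(LINT x|circle. f x)
      = (LINT x|density lborel (\<lambda>x. ennreal (indicator {0..<2 * pi} x / (2 * pi))). f x)"
    by (rule arg_cong)
  also have "\<dots> = (LINT x|lborel. (indicator {0..<2 * pi} x / (2 * pi)) *\<^sub>R f x)"
    by (rule integral_density) auto
  also have "\<dots> = (LINT x|lborel. (indicator {0..<2 * pi} x *\<^sub>R f x) / (2 * pi))"
    by (intro Bochner_Integration.integral_cong refl) (auto simp: scaleR_conv_of_real)
  also have "\<dots> = (LINT x:{0..<2 * pi}|lborel. f x) / (2 * pi)"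
    unfolding set_lebesgue_integral_def by (rule integral_divide_zero)
  finally show ?thesis .
qed

lemma L2_iff: "f \<in> L2 \<longleftrightarrow> f \<in> borel_measurable borel \<and> integrable circle (\<lambda>x. (cmod (f x))\<^sup>2)"
  by (simp add: L2_def measurable_cong_sets[OF sets_circle refl])

lemma L2_measurable [measurable_dest]: "f \<in> L2 \<Longrightarrow> f \<in> borel_measurable borel"
  by (simp add: L2_iff)

lemma L2_I_bounded:
  assumes [measurable]: "f \<in> borel_measurable borel" and "\<And>x. cmod (f x) \<le> B"
  shows "f \<in> L2"
  unfolding L2_iff
proof
  show "integrable circle (\<lambda>x. (cmod (f x))\<^sup>2)"
    by (rule circle.integrable_const_bound[of _ "B\<^sup>2"]) (auto intro!: AE_I2 power_mono assms(2))
qed simp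

lemma norm_add_squared_le: "(cmod (a + b))\<^sup>2 \<le> 2 * (cmod a)\<^sup>2 + 2 * (cmod b)\<^sup>2"
proof -
  have "(cmod (a + b))\<^sup>2 \<le> (cmod a + cmod b)\<^sup>2"
    by (intro power_mono norm_triangle_ineq) auto
  also have "\<dots> \<le> 2 * (cmod a)\<^sup>2 + 2 * (cmod b)\<^sup>2"
    using sum_squares_bound[of "cmod a" "cmod b"] by (simp add: power2_sum)
  finally show ?thesis .
qed

lemma L2_add [intro]:
  assumes "f \<in> L2" "g \<in> L2"
  shows "(\<lambda>x. f x + g x) \<in> L2"
proof -
  have [measurable]: "f \<in> borel_measurable borel" "g \<in> borel_measurable borel"
    using assms by auto
  have "integrable circle (\<lambda>x. 2 * (cmod (f x))\<^sup>2 + 2 * (cmod (g x))\<^sup>2)"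
    using assms by (auto simp: L2_iff)
  then have "integrable circle (\<lambda>x. (cmod (f x + g x))\<^sup>2)"
    by (rule Bochner_Integration.integrable_bound) (auto simp: norm_add_squared_le)
  then show ?thesis by (simp add: L2_iff)
qed

lemma L2_cmult [intro]:
  assumes "f \<in> L2"
  shows "(\<lambda>x. a * f x) \<in> L2"
  using assms by (auto simp: L2_iff norm_mult power_mult_distrib)

lemma L2_diff [intro]:
  assumes "f \<in> L2" "g \<in> L2"
  shows "(\<lambda>x. f x - g x) \<in> L2"
  using L2_add[OF assms(1) L2_cmult[OF assms(2), of "-1"]] by simp

lemma L2_zero [intro, simp]: "(\<lambda>x. 0) \<in> L2"
  by (simp add: L2_iff)

lemma L2_sum [intro]:
  assumes "\<And>i. i \<in> J \<Longrightarrow> f i \<in> L2"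
  shows "(\<lambda>x. \<Sum>i\<in>J. f i x) \<in> L2"
  using assms by (induction J rule: infinite_finite_induct) auto

lemma L2_inner_integrable:
  assumes "f \<in> L2" "g \<in> L2"
  shows "integrable circle (\<lambda>x. f x * cnj (g x))"
proof -
  have [measurable]: "f \<in> borel_measurable borel" "g \<in> borel_measurable borel"
    using assms by auto
  have "integrable circle (\<lambda>x. (cmod (f x))\<^sup>2 + (cmod (g x))\<^sup>2)"
    using assms by (auto simp: L2_iff)
  moreover have "cmod (f x * cnj (g x)) \<le> (cmod (f x))\<^sup>2 + (cmod (g x))\<^sup>2" for x
  proof -
    have "cmod (f x) * cmod (g x) \<le> 2 * (cmod (f x) * cmod (g x))"
      by simp
    also have "\<dots> \<le> (cmod (f x))\<^sup>2 + (cmod (g x))\<^sup>2"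
      using sum_squares_bound[of "cmod (f x)" "cmod (g x)"] by (simp add: mult.assoc)
    finally show ?thesis by (simp add: norm_mult)
  qed
  ultimately show ?thesis
    by (elim Bochner_Integration.integrable_bound) auto
qed

lemma L2_inner_add_left:
  "f \<in> L2 \<Longrightarrow> g \<in> L2 \<Longrightarrow> h \<in> L2 \<Longrightarrow> L2_inner (\<lambda>x. f x + g x) h = L2_inner f h + L2_inner g h"
  unfolding L2_inner_def by (simp add: distrib_right L2_inner_integrable)

lemma L2_inner_cmult_left: "L2_inner (\<lambda>x. a * f x) h = a * L2_inner f h"
  unfolding L2_inner_def by (simp add: mult.assoc)

lemma L2_inner_sum_left:
  assumes "\<And>i. i \<in> J \<Longrightarrow> f i \<in> L2" "h \<in> L2"
  shows "L2_inner (\<lambda>x. \<Sum>i\<in>J. f i x) h = (\<Sum>i\<in>J. L2_inner (f i) h)"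
  unfolding L2_inner_def sum_distrib_right
  by (rule Bochner_Integration.integral_sum) (intro L2_inner_integrable assms)

lemma L2_inner_commute: "L2_inner f g = cnj (L2_inner g f)"
  unfolding L2_inner_def Bochner_Integration.integral_cnj[symmetric]
  by (rule Bochner_Integration.integral_cong) (simp_all add: mult.commute)

lemma L2_inner_cong_left:
  assumes "f \<doteq> f'" "f \<in> L2" "f' \<in> L2" "g \<in> L2"
  shows "L2_inner f g = L2_inner f' g"
proof -
  have [measurable]: "f \<in> borel_measurable borel" "f' \<in> borel_measurable borel" "g \<in> borel_measurable borel"
    using assms by auto
  show ?thesis
    unfolding L2_inner_def using assms(1)
    by (intro integral_cong_AE) (auto simp: L2_eq_def)
qed

lemma L2_norm_cong:
  assumes "f \<doteq> f'" "f \<in> L2" "f' \<in> L2"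
  shows "L2_norm f = L2_norm f'"
proof -
  have [measurable]: "f \<in> borel_measurable borel" "f' \<in> borel_measurable borel"
    using assms by auto
  have "(LINT x|circle. (cmod (f x))\<^sup>2) = (LINT x|circle. (cmod (f' x))\<^sup>2)"
    using assms(1) by (intro integral_cong_AE) (auto simp: L2_eq_def)
  then show ?thesis by (simp add: L2_norm_def)
qed

lemma L2_norm_nonneg [simp]: "0 \<le> L2_norm f"
  by (simp add: L2_norm_def)

lemma L2_norm_squared: "(L2_norm f)\<^sup>2 = (LINT x|circle. (cmod (f x))\<^sup>2)"
  by (simp add: L2_norm_def)

lemma L2_inner_self: "L2_inner f f = of_real ((L2_norm f)\<^sup>2)"
  unfolding L2_inner_def L2_norm_squared
  by (simp flip: integral_complex_of_real complex_norm_square)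

lemma L2_norm_add_squared:
  assumes "f \<in> L2" "g \<in> L2"
  shows "(L2_norm (\<lambda>x. f x + g x))\<^sup>2 = (L2_norm f)\<^sup>2 + 2 * Re (L2_inner f g) + (L2_norm g)\<^sup>2"
proof -
  have *: "(cmod (f x + g x))\<^sup>2 = (cmod (f x))\<^sup>2 + 2 * Re (f x * cnj (g x)) + (cmod (g x))\<^sup>2" for x
    unfolding cmod_power2 by (simp add: power2_eq_square algebra_simps)
  show ?thesis
    unfolding L2_norm_squared L2_inner_def * integral_Re[OF L2_inner_integrable[OF assms], symmetric]
    using assms integrable_Re[OF L2_inner_integrable[OF assms]]
    by (simp add: L2_iff del: integral_Re integrable_Re times_complex.sel)
qed

lemma L2_norm_cmult: "L2_norm (\<lambda>x. a * f x) = cmod a * L2_norm f"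
  by (simp add: L2_norm_def norm_mult power_mult_distrib real_sqrt_mult)

lemma L2_Cauchy_Schwarz:
  assumes f: "f \<in> L2" and g: "g \<in> L2"
  shows "cmod (L2_inner f g) \<le> L2_norm f * L2_norm g"
proof (cases "L2_norm g = 0")
  case True
  have "integrable circle (\<lambda>x. (cmod (g x))\<^sup>2)" using g by (simp add: L2_iff)
  moreover have "(LINT x|circle. (cmod (g x))\<^sup>2) = 0"
    using True by (simp flip: L2_norm_squared)
  ultimately have "AE x in circle. g x = 0"
    by (subst (asm) integral_nonneg_eq_0_iff_AE) auto
  moreover have [measurable]: "f \<in> borel_measurable borel" "g \<in> borel_measurable borel"
    using assms by auto
  ultimately have "L2_inner f g = (LINT x|circle. 0)"
    unfolding L2_inner_def by (intro integral_cong_AE) auto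
  then show ?thesis by (simp add: True)
next
  case False
  \<comment> \<open>With this scalar, \<open>f + a g\<close> is the component of \<open>f\<close>
    orthogonal to \<open>g\<close>; that its squared norm is nonnegative is the claimed
    inequality.\<close>
  define a where "a = - (L2_inner f g / of_real ((L2_norm g)\<^sup>2))"
  have pos: "L2_norm g > 0" using False L2_norm_nonneg[of g] by linarith
  have "0 \<le> (L2_norm (\<lambda>x. f x + a * g x))\<^sup>2" by simp
  also have "\<dots> = (L2_norm f)\<^sup>2 + 2 * Re (L2_inner f (\<lambda>x. a * g x)) + (cmod a * L2_norm g)\<^sup>2"
    using assms by (simp add: L2_norm_add_squared L2_cmult L2_norm_cmult)
  also have "L2_inner f (\<lambda>x. a * g x) = cnj a * L2_inner f g"
    by (subst (1 2) L2_inner_commute) (simp add: L2_inner_cmult_left)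
  also have "\<dots> = - of_real ((cmod (L2_inner f g))\<^sup>2 / (L2_norm g)\<^sup>2)"
    unfolding a_def by (simp add: complex_norm_square mult.commute del: of_real_power)
  also have "cmod a * L2_norm g = cmod (L2_inner f g) / L2_norm g"
    unfolding a_def using pos by (simp add: norm_divide norm_power power2_eq_square norm_mult)
  finally have "(cmod (L2_inner f g))\<^sup>2 / (L2_norm g)\<^sup>2 \<le> (L2_norm f)\<^sup>2"
    by (simp add: power_divide)
  then have "(cmod (L2_inner f g))\<^sup>2 \<le> (L2_norm f * L2_norm g)\<^sup>2"
    using pos by (simp add: field_simps)
  then show ?thesis by (rule power2_le_imp_le) simp
qed

lemma L2_norm_triangle:
  assumes "f \<in> L2" "g \<in> L2"
  shows "L2_norm (\<lambda>x. f x + g x) \<le> L2_norm f + L2_norm g"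
proof (rule power2_le_imp_le)
  have "Re (L2_inner f g) \<le> L2_norm f * L2_norm g"
    using L2_Cauchy_Schwarz[OF assms] complex_Re_le_cmod order_trans by blast
  then show "(L2_norm (\<lambda>x. f x + g x))\<^sup>2 \<le> (L2_norm f + L2_norm g)\<^sup>2"
    using assms by (simp add: L2_norm_add_squared power2_sum)
qed simp

lemma L2_norm_triangle_diff:
  assumes "f \<in> L2" "g \<in> L2" "h \<in> L2"
  shows "L2_norm (\<lambda>x. f x - h x) \<le> L2_norm (\<lambda>x. f x - g x) + L2_norm (\<lambda>x. g x - h x)"
  using L2_norm_triangle[of "\<lambda>x. f x - g x" "\<lambda>x. g x - h x"] assms by auto

text \<open>The total mass of \<open>circle\<close> is one, so a uniform bound on the fundamental
  domain is also a bound for the norm. This turns uniform approximation into approximation in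
  \<open>L2\<close>.\<close>

lemma L2_norm_le_sup:
  assumes "\<And>x. 0 \<le> x \<Longrightarrow> x < 2 * pi \<Longrightarrow> cmod (f x) \<le> B" "f \<in> L2" "0 \<le> B"
  shows "L2_norm f \<le> B"
proof -
  have "(LINT x|circle. (cmod (f x))\<^sup>2) \<le> (LINT x|circle. B\<^sup>2)"
    using assms by (intro integral_mono_AE) (auto simp: L2_iff intro!: AE_circle_I power_mono)
  also have "\<dots> = B\<^sup>2" using emeasure_circle by (simp add: measure_def)
  finally show ?thesis
    using assms(3) by (simp add: L2_norm_def real_le_lsqrt)
qed

section \<open>The Fourier basis\<close>

lemma fourier_basis_L2 [intro, simp]: "fourier_basis k \<in> L2"
proof (rule L2_I_bounded)
  show "fourier_basis k \<in> borel_measurable borel"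
    unfolding fourier_basis_def
    by (intro borel_measurable_continuous_onI continuous_intros)
  show "cmod (fourier_basis k x) \<le> 1" for x
    by (simp add: fourier_basis_def)
qed

lemma fourier_basis_mult: "fourier_basis j x * fourier_basis k x = fourier_basis (j + k) x"
  by (simp add: fourier_basis_def algebra_simps flip: exp_add)

lemma fourier_basis_orthonormal:
  "L2_inner (fourier_basis j) (fourier_basis k) = (if j = k then 1 else 0)"
proof -
  define n where "n = j - k"
  have [measurable]: "fourier_basis i \<in> borel_measurable borel" for i
    by (rule L2_measurable) simp
  have "fourier_basis j x * cnj (fourier_basis k x) = fourier_basis n x" for x
    by (simp add: fourier_basis_def n_def algebra_simps exp_cnj flip: exp_add)
  then have 1: "L2_inner (fourier_basis j) (fourier_basis k)
      = (LINT x:{0..<2 * pi}|lborel. fourier_basis n x) / (2 * pi)"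
    unfolding L2_inner_def by (simp add: integral_circle)
  \<comment> \<open>Adding the endpoint, a null set, gives the closed interval on which the
    fundamental theorem of calculus is stated.\<close>
  also have "(LINT x:{0..<2 * pi}|lborel. fourier_basis n x)
      = (LINT x:{0..2 * pi}|lborel. fourier_basis n x)"
    by (rule set_integral_cong_set)
       (auto simp: set_borel_measurable_def intro!: eventually_mono[OF AE_lborel_singleton[of "2 * pi"]])
  also have "\<dots> = (if n = 0 then 2 * pi else 0)"
  proof (cases "n = 0")
    case True
    then show ?thesis 
      by (simp add: fourier_basis_def set_lebesgue_integral_def scaleR_conv_of_real)
  next
    case False
    have "(LINT x:{0..2 * pi}|lborel. fourier_basis n x)
        = fourier_basis n (2 * pi) / (\<i> * of_int n) - fourier_basis n 0 / (\<i> * of_int n)"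
      unfolding set_lebesgue_integral_def
    proof (rule integral_FTC_atLeastAtMost)
      fix x :: real
      have "((\<lambda>z. exp (\<i> * of_int n * z) / (\<i> * of_int n)) has_field_derivative
              exp (\<i> * of_int n * of_real x)) (at (of_real x))"
        using False by (auto intro!: derivative_eq_intros)
      from has_vector_derivative_real_field[OF this]
      show "((\<lambda>x. fourier_basis n x / (\<i> * of_int n)) has_vector_derivative fourier_basis n x)
              (at x within {0..2 * pi})"
        by (simp add: fourier_basis_def o_def)
    qed (auto simp: fourier_basis_def intro!: continuous_intros)
    also have "fourier_basis n (2 * pi) = 1"
      unfolding fourier_basis_def
      using exp_integer_2pi[of "of_int n"] by (simp add: mult_ac)
    finally show ?thesis using False by (simp add: fourier_basis_def)
  qed
  finally show ?thesis by (auto simp: n_def)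
qed

section \<open>Density of trigonometric polynomials\<close>

text \<open>Generation by closure rules makes stability under products a plain induction; the
  explicit finite sums are recovered in \<open>trig_poly_sum_form\<close>.\<close>

inductive_set trig_poly :: "(real \<Rightarrow> complex) set" where
  basis: "fourier_basis k \<in> trig_poly"
| cmult: "f \<in> trig_poly \<Longrightarrow> (\<lambda>x. a * f x) \<in> trig_poly"
| add: "f \<in> trig_poly \<Longrightarrow> g \<in> trig_poly \<Longrightarrow> (\<lambda>x. f x + g x) \<in> trig_poly"

lemma trig_poly_L2: "f \<in> trig_poly \<Longrightarrow> f \<in> L2"
  by (induction rule: trig_poly.induct) auto

lemma trig_poly_const: "(\<lambda>x. c) \<in> trig_poly"
  using trig_poly.cmult[OF trig_poly.basis[of 0], of c] by (simp add: fourier_basis_def)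

text \<open>Linearity in each factor reduces the product to two basis functions, whose indices
  add.\<close>

lemma trig_poly_mult:
  assumes "f \<in> trig_poly" "g \<in> trig_poly"
  shows "(\<lambda>x. f x * g x) \<in> trig_poly"
  using assms(1)
proof induction
  case (basis j)
  show ?case using assms(2)
  proof induction
    case (basis k)
    then show ?case by (simp add: fourier_basis_mult trig_poly.basis)
  next
    case (cmult f a)
    then show ?case using trig_poly.cmult by (fastforce simp: mult.left_commute)
  next
    case (add f g)
    then show ?case using trig_poly.add by (fastforce simp: distrib_left)
  qed
next
  case (cmult f a)
  then show ?case using trig_poly.cmult by (fastforce simp: mult.assoc)
next
  case (add f g)
  then show ?case using trig_poly.add by (fastforce simp: distrib_right)
qed

lemma trig_poly_sum_form:
  assumes "f \<in> trig_poly"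
  obtains J a where "finite J" "f = (\<lambda>x. \<Sum>k\<in>J. a k * fourier_basis k x)"
proof -
  have "\<exists>J a. finite J \<and> f = (\<lambda>x. \<Sum>k\<in>J. a k * fourier_basis k x)"
    using assms
  proof induction
    case (basis k)
    show ?case by (rule exI[of _ "{k}"], rule exI[of _ "\<lambda>_. 1"]) auto
  next
    case (cmult f a)
    then obtain J b where "finite J" "f = (\<lambda>x. \<Sum>k\<in>J. b k * fourier_basis k x)" by blast
    then show ?case
      by (intro exI[of _ J] exI[of _ "\<lambda>k. a * b k"]) (auto simp: sum_distrib_left mult.assoc)
  next
    case (add f g)
    then obtain J a K b where J: "finite J" "f = (\<lambda>x. \<Sum>k\<in>J. a k * fourier_basis k x)"
      and K: "finite K" "g = (\<lambda>x. \<Sum>k\<in>K. b k * fourier_basis k x)" by blast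
    have "f = (\<lambda>x. \<Sum>k\<in>J \<union> K. (if k \<in> J then a k else 0) * fourier_basis k x)"
      unfolding J(2) using J(1) K(1) by (intro ext sum.mono_neutral_cong_left) auto
    moreover have "g = (\<lambda>x. \<Sum>k\<in>J \<union> K. (if k \<in> K then b k else 0) * fourier_basis k x)"
      unfolding K(2) using J(1) K(1) by (intro ext sum.mono_neutral_cong_left) auto
    ultimately have "(\<lambda>x. f x + g x) = (\<lambda>x. \<Sum>k\<in>J \<union> K.
        ((if k \<in> J then a k else 0) + (if k \<in> K then b k else 0)) * fourier_basis k x)"
      by (simp only: distrib_right sum.distrib)
    then show ?case using J(1) K(1)
      by (intro exI[of _ "J \<union> K"]
          exI[of _ "\<lambda>k. (if k \<in> J then a k else 0) + (if k \<in> K then b k else 0)"]) auto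
  qed
  then show ?thesis using that by blast
qed

text \<open>The coordinates of \<open>cis x\<close> are cosine and sine, hence combinations of the
  basis functions of index 1 and -1; sums and products stay inside \<open>trig_poly\<close>.\<close>

lemma trig_poly_real_polynomial_cis:
  fixes p :: "complex \<Rightarrow> real"
  assumes "real_polynomial_function p"
  shows "(\<lambda>x. complex_of_real (p (cis x))) \<in> trig_poly"
  using assms
proof induction
  case (linear f)
  \<comment> \<open>A real-linear form on the plane is determined by its values at \<open>1\<close>
    and \<open>\<i>\<close>; Euler's formulas for cosine and sine give the two coefficients.\<close>
  have "complex_of_real (f (cis x))
      = ((f 1 - \<i> * f \<i>) / 2) * fourier_basis 1 x + ((f 1 + \<i> * f \<i>) / 2) * fourier_basis (-1) x" for x
  proof -
    have "cis x = cos x *\<^sub>R 1 + sin x *\<^sub>R \<i>"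
      by (simp add: complex_eq_iff)
    then have "f (cis x) = cos x * f 1 + sin x * f \<i>"
      using linear by (simp only: real_vector.linear_add real_vector.linear_scale bounded_linear.linear real_scaleR_def)
    moreover have "fourier_basis 1 x = cos x + \<i> * sin x" "fourier_basis (-1) x = cos x - \<i> * sin x"
      by (simp_all add: fourier_basis_def flip: cis_conv_exp cis_cnj)
         (simp_all add: complex_eq_iff Re_exp Im_exp)
    ultimately show ?thesis
      by (simp add: complex_eq_iff field_simps)
  qed
  then show ?case by (simp only:) (intro trig_poly.intros)
next
  case (const c)
  show ?case by (rule trig_poly_const)
next
  case (add f g)
  then show ?case using trig_poly.add by fastforce
next
  case (mult f g)
  then show ?case using trig_poly_mult by fastforce
qed

section \<open>The closure of the trigonometric polynomials, shown to be all of
  \<open>L2\<close>\<close>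

definition trig_closure :: "(real \<Rightarrow> complex) set" where
  "trig_closure = {f \<in> L2. \<forall>\<epsilon>>0. \<exists>p\<in>trig_poly. L2_norm (\<lambda>x. f x - p x) < \<epsilon>}"

lemma trig_closure_L2: "f \<in> trig_closure \<Longrightarrow> f \<in> L2"
  by (simp add: trig_closure_def)

text \<open>The closure is closed: half of the error is spent on an element of the closure, half on
  a polynomial near that element.\<close>

lemma trig_closure_limit:
  assumes f: "f \<in> L2" and g: "\<And>\<epsilon>. \<epsilon> > 0 \<Longrightarrow> \<exists>g\<in>trig_closure. L2_norm (\<lambda>x. f x - g x) < \<epsilon>"
  shows "f \<in> trig_closure"
  unfolding trig_closure_def
proof (safe intro!: f)
  fix \<epsilon> :: real assume "\<epsilon> > 0"
  then have "\<epsilon> / 2 > 0" by simp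
  from g[OF this] obtain g where g: "g \<in> trig_closure" "L2_norm (\<lambda>x. f x - g x) < \<epsilon> / 2" by blast
  with \<open>\<epsilon> / 2 > 0\<close> obtain p where p: "p \<in> trig_poly" "L2_norm (\<lambda>x. g x - p x) < \<epsilon> / 2"
    unfolding trig_closure_def by blast
  have "L2_norm (\<lambda>x. f x - p x) \<le> L2_norm (\<lambda>x. f x - g x) + L2_norm (\<lambda>x. g x - p x)"
    using g(1) p(1) by (intro L2_norm_triangle_diff f) (auto intro: trig_poly_L2 trig_closure_L2)
  then show "\<exists>p\<in>trig_poly. L2_norm (\<lambda>x. f x - p x) < \<epsilon>"
    using g p by (intro bexI[of _ p]) auto
qed

lemma trig_poly_closure: "p \<in> trig_poly \<Longrightarrow> p \<in> trig_closure"
  unfolding trig_closure_def by (auto intro!: trig_poly_L2 bexI[of _ p] simp: L2_norm_def)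

lemma trig_closure_cmult:
  assumes "f \<in> trig_closure"
  shows "(\<lambda>x. a * f x) \<in> trig_closure"
proof (rule trig_closure_limit)
  show "(\<lambda>x. a * f x) \<in> L2" using assms by (auto simp: trig_closure_def)
  fix \<epsilon> :: real assume \<epsilon>: "\<epsilon> > 0"
  \<comment> \<open>The added 1 keeps the denominator positive when \<open>a\<close> is
    zero.\<close>
  then have "\<epsilon> / (cmod a + 1) > 0" by (simp add: add_nonneg_pos)
  then obtain p where p: "p \<in> trig_poly" "L2_norm (\<lambda>x. f x - p x) < \<epsilon> / (cmod a + 1)"
    using assms unfolding trig_closure_def by blast
  have "L2_norm (\<lambda>x. a * f x - a * p x) = cmod a * L2_norm (\<lambda>x. f x - p x)"
    using L2_norm_cmult[of a "\<lambda>x. f x - p x"] by (simp add: right_diff_distrib)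
  also have "\<dots> \<le> (cmod a + 1) * L2_norm (\<lambda>x. f x - p x)"
    by (intro mult_right_mono) auto
  also have "\<dots> < \<epsilon>"
    using p(2) by (simp add: pos_less_divide_eq add_nonneg_pos mult.commute)
  finally show "\<exists>g\<in>trig_closure. L2_norm (\<lambda>x. a * f x - g x) < \<epsilon>"
    using p(1) by (intro bexI[of _ "\<lambda>x. a * p x"] trig_poly_closure trig_poly.cmult)
qed

lemma trig_closure_add:
  assumes "f \<in> trig_closure" "g \<in> trig_closure"
  shows "(\<lambda>x. f x + g x) \<in> trig_closure"
proof (rule trig_closure_limit)
  have L2: "f \<in> L2" "g \<in> L2" using assms by (auto simp: trig_closure_def)
  then show "(\<lambda>x. f x + g x) \<in> L2" by auto
  fix \<epsilon> :: real assume "\<epsilon> > 0"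
  then have "\<epsilon> / 2 > 0" by simp
  then obtain p q where p: "p \<in> trig_poly" "L2_norm (\<lambda>x. f x - p x) < \<epsilon> / 2"
    and q: "q \<in> trig_poly" "L2_norm (\<lambda>x. g x - q x) < \<epsilon> / 2"
    using assms unfolding trig_closure_def by blast
  have "L2_norm (\<lambda>x. (f x + g x) - (p x + q x)) = L2_norm (\<lambda>x. (f x - p x) + (g x - q x))"
    by (simp add: algebra_simps)
  also have "\<dots> \<le> L2_norm (\<lambda>x. f x - p x) + L2_norm (\<lambda>x. g x - q x)"
    using L2 p q by (intro L2_norm_triangle) (auto intro: trig_poly_L2)
  also have "\<dots> < \<epsilon>" using p q by simp
  finally show "\<exists>h\<in>trig_closure. L2_norm (\<lambda>x. f x + g x - h x) < \<epsilon>"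
    using p(1) q(1) by (intro bexI[of _ "\<lambda>x. p x + q x"] trig_poly_closure trig_poly.add)
qed

lemma trig_closure_zero: "(\<lambda>x. 0) \<in> trig_closure"
  by (intro trig_poly_closure trig_poly_const)

lemma trig_closure_sum:
  assumes "\<And>i. i \<in> J \<Longrightarrow> f i \<in> trig_closure"
  shows "(\<lambda>x. \<Sum>i\<in>J. f i x) \<in> trig_closure"
  using assms
  by (induction J rule: infinite_finite_induct) (auto intro: trig_closure_add trig_closure_zero)

text \<open>Since \<open>cmod (f x - g n x)\<close> is at most \<open>2 * h x\<close>, dominated
  convergence with the bound \<open>4 * (h x)\<^sup>2\<close> yields convergence in norm. Limit and
  bound are required only on the fundamental domain, because \<open>circle\<close> ignores the rest
  of the line.\<close>

lemma trig_closure_dominated_limit: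
  assumes f [measurable]: "f \<in> borel_measurable borel" and g: "\<And>n. g n \<in> trig_closure"
    and lim: "\<And>x. 0 \<le> x \<Longrightarrow> x < 2 * pi \<Longrightarrow> (\<lambda>n. g n x) \<longlonglongrightarrow> f x"
    and bound: "\<And>n x. 0 \<le> x \<Longrightarrow> x < 2 * pi \<Longrightarrow> cmod (g n x) \<le> h x"
    and h: "integrable circle (\<lambda>x. (h x)\<^sup>2)"
  shows "f \<in> trig_closure"
proof (rule trig_closure_limit)
  have [measurable]: "g n \<in> borel_measurable borel" for n
    using g by (intro L2_measurable trig_closure_L2)
  have fh: "cmod (f x) \<le> h x" if "0 \<le> x" "x < 2 * pi" for x
    using bound[OF that] by (intro LIMSEQ_le_const2[OF tendsto_norm[OF lim[OF that]]]) auto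
  have "integrable circle (\<lambda>x. (cmod (f x))\<^sup>2)"
    by (rule Bochner_Integration.integrable_bound[OF h])
       (auto intro!: AE_circle_I power_mono fh)
  then show fL2: "f \<in> L2" by (simp add: L2_iff)
  have "(\<lambda>n. LINT x|circle. (cmod (f x - g n x))\<^sup>2) \<longlonglongrightarrow> (LINT x|circle. 0)"
  proof (rule integral_dominated_convergence)
    show "integrable circle (\<lambda>x. 4 * (h x)\<^sup>2)" using h by simp
    show "AE x in circle. (\<lambda>n. (cmod (f x - g n x))\<^sup>2) \<longlonglongrightarrow> 0"
    proof (rule AE_circle_I)
      fix x assume "0 \<le> x" "x < 2 * pi"
      then have "(\<lambda>n. (cmod (f x - g n x))\<^sup>2) \<longlonglongrightarrow> (cmod (f x - f x))\<^sup>2"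
        by (intro tendsto_intros lim)
      then show "(\<lambda>n. (cmod (f x - g n x))\<^sup>2) \<longlonglongrightarrow> 0" by simp
    qed
    show "AE x in circle. norm ((cmod (f x - g n x))\<^sup>2) \<le> 4 * (h x)\<^sup>2" for n
    proof (rule AE_circle_I)
      fix x assume x: "0 \<le> x" "x < 2 * pi"
      have "cmod (f x - g n x) \<le> 2 * h x"
        using norm_triangle_ineq4[of "f x" "g n x"] fh[OF x] bound[OF x, of n] by linarith
      then have "(cmod (f x - g n x))\<^sup>2 \<le> (2 * h x)\<^sup>2"
        by (intro power_mono) auto
      then show "norm ((cmod (f x - g n x))\<^sup>2) \<le> 4 * (h x)\<^sup>2"
        by (simp add: power_mult_distrib)
    qed
  qed auto
  then have "(\<lambda>n. sqrt (LINT x|circle. (cmod (f x - g n x))\<^sup>2)) \<longlonglongrightarrow> sqrt 0"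
    by (intro tendsto_real_sqrt) simp
  then have lim0: "(\<lambda>n. L2_norm (\<lambda>x. f x - g n x)) \<longlonglongrightarrow> 0"
    by (simp add: L2_norm_def)
  fix \<epsilon> :: real assume "\<epsilon> > 0"
  with lim0 have "\<forall>\<^sub>F n in sequentially. L2_norm (\<lambda>x. f x - g n x) < \<epsilon>"
    by (rule order_tendstoD)
  then show "\<exists>g\<in>trig_closure. L2_norm (\<lambda>x. f x - g x) < \<epsilon>"
    using g by (auto simp: eventually_sequentially)
qed

lemma measurable_cis [measurable]: "cis \<in> borel_measurable borel"
  by (intro borel_measurable_continuous_onI continuous_intros)

lemma measurable_Arg2pi [measurable]: "Arg2pi \<in> borel_measurable borel"
  by (rule borel_measurableI_greater) (simp add: open_Arg2pi2pi_gt)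

text \<open>Stone-Weierstrass on the unit circle gives polynomials uniformly close to
  \<open>F\<close>. Composition with \<open>cis\<close> takes care of periodicity.\<close>

lemma trig_closure_continuous_cis:
  fixes F :: "complex \<Rightarrow> real"
  assumes "continuous_on UNIV F"
  shows "(\<lambda>x. complex_of_real (F (cis x))) \<in> trig_closure"
proof (rule trig_closure_limit)
  have [measurable]: "F \<in> borel_measurable borel"
    by (rule borel_measurable_continuous_onI) fact
  have comp: "compact (sphere (0::complex) 1)" and cont: "continuous_on (sphere 0 1) F"
    using assms continuous_on_subset by auto
  obtain B where "\<forall>y\<in>F ` sphere 0 1. norm y \<le> B"
    using compact_imp_bounded[OF compact_continuous_image[OF cont comp]] by (metis bounded_iff)
  then have B: "norm (F z) \<le> B" if "z \<in> sphere 0 1" for z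
    using that by blast
  show L2: "(\<lambda>x. complex_of_real (F (cis x))) \<in> L2"
    using B by (intro L2_I_bounded[of _ B]) auto
  fix \<epsilon> :: real assume "\<epsilon> > 0"
  then have "\<epsilon> / 2 > 0" by simp
  obtain p where p: "real_polynomial_function p" "\<And>z. z \<in> sphere 0 1 \<Longrightarrow> \<bar>F z - p z\<bar> < \<epsilon> / 2"
    using Stone_Weierstrass_real_polynomial_function[OF comp cont \<open>\<epsilon> / 2 > 0\<close>] by metis
  have trig: "(\<lambda>x. complex_of_real (p (cis x))) \<in> trig_poly"
    by (rule trig_poly_real_polynomial_cis) fact
  \<comment> \<open>\<open>L2_norm_le_sup\<close> yields only a weak inequality; the factor 1/2
    makes the final one strict.\<close>
  have "L2_norm (\<lambda>x. complex_of_real (F (cis x)) - complex_of_real (p (cis x))) \<le> \<epsilon> / 2"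
    using \<open>\<epsilon> > 0\<close> p(2) L2 trig
    by (intro L2_norm_le_sup L2_diff)
       (auto simp flip: of_real_diff intro: trig_poly_L2 intro!: less_imp_le)
  then show "\<exists>g\<in>trig_closure. L2_norm (\<lambda>x. complex_of_real (F (cis x)) - g x) < \<epsilon>"
    using \<open>\<epsilon> > 0\<close> by (intro bexI[OF _ trig_poly_closure[OF trig]]) auto
qed

lemma trig_closure_closed_cis:
  assumes "closed C"
  shows "(\<lambda>x. indicator C (cis x)) \<in> trig_closure"
\<comment> \<open>By convention \<open>infdist z {}\<close> is 0, so for empty \<open>C\<close> the
  functions \<open>F n\<close> below would be constantly 1 instead of tending to 0.\<close>
proof (cases "C = {}")
  case True
  then show ?thesis by (simp add: trig_closure_zero)
next
  case False
  have [measurable]: "C \<in> sets borel" using assms by simp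
  \<comment> \<open>Continuous tent functions equal to 1 on \<open>C\<close> and, for positive
    \<open>n\<close>, zero at distance at least \<open>1 / n\<close> from it. As \<open>C\<close> is
    closed, they tend pointwise to its indicator.\<close>
  define F where "F n z = max 0 (1 - real n * infdist z C)" for n z
  show ?thesis
  proof (rule trig_closure_dominated_limit)
    show "(\<lambda>x. complex_of_real (F n (cis x))) \<in> trig_closure" for n
      unfolding F_def by (intro trig_closure_continuous_cis continuous_intros)
    show "(\<lambda>n. complex_of_real (F n (cis x))) \<longlonglongrightarrow> indicator C (cis x)" for x
    proof (cases "cis x \<in> C")
      case True
      then show ?thesis by (simp add: F_def)
    next
      case out: False
      then have pos: "infdist (cis x) C > 0"
        using assms False by (simp add: infdist_pos_not_in_closed)
      obtain N where N: "real N * infdist (cis x) C > 1"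
        using reals_Archimedean3[OF pos] by blast
      have "F n (cis x) = 0" if "n \<ge> N" for n
      proof -
        have "real N * infdist (cis x) C \<le> real n * infdist (cis x) C"
          using that pos by (intro mult_right_mono) auto
        with N show ?thesis by (simp add: F_def)
      qed
      then have "\<forall>\<^sub>F n in sequentially. complex_of_real (F n (cis x)) = indicator C (cis x)"
        using out by (auto simp: eventually_sequentially)
      then show ?thesis by (rule tendsto_eventually)
    qed
    show "cmod (complex_of_real (F n (cis x))) \<le> 1" for n x
      by (simp add: F_def infdist_nonneg)
  qed auto
qed

text \<open>Dynkin's argument: the closed sets are stable under intersection and generate the Borel
  sets, and membership in \<open>trig_closure\<close> survives complements and countable disjoint
  unions.\<close>

lemma trig_closure_borel_cis:
  assumes "B \<in> sets borel"
  shows "(\<lambda>x. indicator B (cis x)) \<in> trig_closure"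
proof -
  have "Int_stable (Collect closed :: complex set set)" "Collect closed \<subseteq> Pow (UNIV :: complex set)"
    "B \<in> sigma_sets UNIV (Collect closed)"
    using assms by (auto simp: Int_stable_def borel_eq_closed)
  then show ?thesis
  proof (induction rule: sigma_sets_induct_disjoint)
    case (basic A)
    then show ?case by (simp add: trig_closure_closed_cis)
  next
    case empty
    then show ?case by (simp add: trig_closure_zero)
  next
    case (compl A)
    have "(\<lambda>x. indicator (UNIV - A) (cis x)) = (\<lambda>x. 1 + (-1) * indicator A (cis x) :: complex)"
      by (auto simp: indicator_def)
    with compl show ?case
      by (simp only: trig_closure_add[OF trig_poly_closure[OF trig_poly_const] trig_closure_cmult])
  next
    case (union A)
    have [measurable]: "A i \<in> sets borel" for i
      using union(2) by (auto simp: borel_eq_closed)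
    show ?case
    proof (rule trig_closure_dominated_limit)
      show "(\<lambda>x. indicator (\<Union>i. A i) (cis x)) \<in> borel_measurable borel"
        by (rule measurable_compose[OF measurable_cis]) measurable
      show "(\<lambda>x. \<Sum>i<n. indicator (A i) (cis x)) \<in> trig_closure" for n
        by (intro trig_closure_sum union)
      \<comment> \<open>Disjointness makes the partial sums indicators again, so the constant 1
        dominates them.\<close>
      have *: "(\<Sum>i<n. indicator (A i) z) = (indicator (\<Union>i<n. A i) z :: complex)" for n z
        using union(1) by (intro indicator_UN_disjoint[symmetric]) (auto simp: disjoint_family_on_def)
      show "(\<lambda>n. \<Sum>i<n. indicator (A i) (cis x)) \<longlonglongrightarrow> (indicator (\<Union>i. A i) (cis x) :: complex)" for x
        unfolding * by (rule LIMSEQ_indicator_UN)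
      show "cmod (\<Sum>i<n. indicator (A i) (cis x)) \<le> 1" for n x
        unfolding * by (simp add: indicator_def)
    qed auto
  qed
qed

text \<open>On the fundamental domain \<open>Arg2pi\<close> inverts \<open>cis\<close>, so there
  \<open>indicator A\<close> equals the indicator of a Borel set in the plane composed with
  \<open>cis\<close>. The limit lemma, used with a constant sequence, ignores the disagreement
  elsewhere.\<close>

lemma trig_closure_borel:
  fixes A :: "real set"
  assumes [measurable]: "A \<in> sets borel"
  shows "indicator A \<in> trig_closure"
proof (rule trig_closure_dominated_limit)
  have "Arg2pi -` A \<inter> space borel \<in> sets borel"
    by (rule measurable_sets) measurable
  then show "(\<lambda>x. indicator (Arg2pi -` A) (cis x)) \<in> trig_closure"
    by (intro trig_closure_borel_cis) simp
  show "(\<lambda>n. indicator (Arg2pi -` A) (cis x)) \<longlonglongrightarrow> (indicator A x :: complex)"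
    if "0 \<le> x" "x < 2 * pi" for x
    using that by (simp add: indicator_def cis_conv_exp Arg2pi_exp)
  show "cmod (indicator (Arg2pi -` A) (cis x)) \<le> 1" for x
    by (simp add: indicator_def)
qed auto

text \<open>Simple functions are finite combinations of Borel indicators, and a measurable
  \<open>f\<close> is a pointwise limit of simple functions dominated by
  \<open>2 * cmod (f x)\<close>.\<close>

lemma trig_poly_dense: "trig_closure = L2"
proof
  show "trig_closure \<subseteq> L2" by (auto simp: trig_closure_def)
  show "L2 \<subseteq> trig_closure"
  proof
    fix f assume f: "f \<in> L2"
    then have [measurable]: "f \<in> borel_measurable borel" by auto
    then obtain s where s: "\<And>n. simple_function borel (s n)" "\<And>x. (\<lambda>n. s n x) \<longlonglongrightarrow> f x"
        "\<And>n x. cmod (s n x) \<le> 2 * cmod (f x)"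
      using borel_measurable_implies_sequence_metric[of f borel 0] by (auto simp: dist_norm)
    show "f \<in> trig_closure"
    proof (rule trig_closure_dominated_limit)
      fix n
      have fin: "finite (range (s n))" and sets: "s n -` {y} \<in> sets borel" for y
        using simple_functionD(1)[OF s(1)] simple_functionD(2)[OF s(1), of n "{y}"] by simp_all
      have eq: "(\<Sum>y\<in>range (s n). y * indicator (s n -` {y}) x) = s n x" for x
      proof -
        have "(\<Sum>y\<in>range (s n). y * indicator (s n -` {y}) x) = (\<Sum>y\<in>range (s n). if y = s n x then y else 0)"
          by (rule sum.cong) (auto simp: indicator_def)
        also have "\<dots> = s n x" using fin by simp
        finally show ?thesis .
      qed
      have "(\<lambda>x. \<Sum>y\<in>range (s n). y * indicator (s n -` {y}) x) \<in> trig_closure"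
        by (rule trig_closure_sum, rule trig_closure_cmult, rule trig_closure_borel, rule sets)
      then show "s n \<in> trig_closure" by (simp only: eq)
    next
      show "integrable circle (\<lambda>x. (2 * cmod (f x))\<^sup>2)"
        using f by (simp add: L2_iff power_mult_distrib)
    qed (use s in auto)
  qed
qed

section \<open>Bounded functionals and orthonormal systems\<close>

text \<open>Pythagoras, for arbitrary finite orthonormal families because it also serves the images
  of the Fourier basis under a unitary operator.\<close>

lemma L2_norm_orthonormal_sum:
  assumes "finite J" "\<And>i. i \<in> J \<Longrightarrow> b i \<in> L2"
    and "\<And>i j. i \<in> J \<Longrightarrow> j \<in> J \<Longrightarrow> L2_inner (b i) (b j) = (if i = j then 1 else 0)"
  shows "(L2_norm (\<lambda>x. \<Sum>i\<in>J. a i * b i x))\<^sup>2 = (\<Sum>i\<in>J. (cmod (a i))\<^sup>2)"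
proof -
  let ?p = "\<lambda>x. \<Sum>i\<in>J. a i * b i x"
  have p: "?p \<in> L2" using assms by (intro L2_sum L2_cmult) auto
  have left: "L2_inner ?p g = (\<Sum>i\<in>J. a i * L2_inner (b i) g)" if "g \<in> L2" for g
    using assms that by (subst L2_inner_sum_left) (auto simp: L2_inner_cmult_left)
  have "L2_inner (b i) ?p = cnj (a i)" if "i \<in> J" for i
  proof -
    have "L2_inner (b i) ?p = cnj (\<Sum>j\<in>J. a j * L2_inner (b j) (b i))"
      using left[of "b i"] assms that by (subst L2_inner_commute) simp
    also have "(\<Sum>j\<in>J. a j * L2_inner (b j) (b i)) = (\<Sum>j\<in>J. if j = i then a j else 0)"
      using assms(3) that by (intro sum.cong) auto
    also have "\<dots> = a i" using assms(1) that by simp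
    finally show ?thesis .
  qed
  then have "L2_inner ?p ?p = (\<Sum>i\<in>J. a i * cnj (a i))"
    by (subst left[OF p]) simp
  also have "\<dots> = of_real (\<Sum>i\<in>J. (cmod (a i))\<^sup>2)"
    by (simp only: complex_norm_square of_real_sum)
  finally show ?thesis
    by (simp only: L2_inner_self of_real_eq_iff)
qed

text \<open>Completing the square in the coefficients. The choice of \<open>a\<close> as the Fourier
  coefficients gives Bessel's inequality, and the last sum shows that this choice minimizes the
  distance.\<close>

lemma L2_norm_diff_trig:
  assumes "finite J" "f \<in> L2"
  shows "(L2_norm (\<lambda>x. f x - (\<Sum>k\<in>J. a k * fourier_basis k x)))\<^sup>2
    = (L2_norm f)\<^sup>2 - (\<Sum>k\<in>J. (cmod (L2_inner f (fourier_basis k)))\<^sup>2)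
      + (\<Sum>k\<in>J. (cmod (a k - L2_inner f (fourier_basis k)))\<^sup>2)"
proof -
  let ?c = "\<lambda>k. L2_inner f (fourier_basis k)"
  let ?p = "\<lambda>x. \<Sum>k\<in>J. (- a k) * fourier_basis k x"
  have p: "?p \<in> L2" by (intro L2_sum L2_cmult) simp
  have "L2_inner ?p f = (\<Sum>k\<in>J. (- a k) * L2_inner (fourier_basis k) f)"
    using assms by (subst L2_inner_sum_left[OF L2_cmult]) (simp_all only: L2_inner_cmult_left fourier_basis_L2)
  then have inner: "L2_inner f ?p = (\<Sum>k\<in>J. cnj (- a k) * ?c k)"
    by (subst L2_inner_commute) (simp flip: L2_inner_commute)
  have "(L2_norm (\<lambda>x. f x - (\<Sum>k\<in>J. a k * fourier_basis k x)))\<^sup>2 = (L2_norm (\<lambda>x. f x + ?p x))\<^sup>2"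
    by (simp add: sum_negf)
  also have "\<dots> = (L2_norm f)\<^sup>2 + 2 * Re (L2_inner f ?p) + (L2_norm ?p)\<^sup>2"
    using assms p by (rule_tac L2_norm_add_squared)
  also have "(L2_norm ?p)\<^sup>2 = (\<Sum>k\<in>J. (cmod (- a k))\<^sup>2)"
    using assms by (intro L2_norm_orthonormal_sum) (auto simp: fourier_basis_orthonormal)
  also have "(L2_norm f)\<^sup>2 + 2 * Re (L2_inner f ?p) + (\<Sum>k\<in>J. (cmod (- a k))\<^sup>2)
      = (L2_norm f)\<^sup>2 + (\<Sum>k\<in>J. 2 * Re (cnj (- a k) * ?c k) + (cmod (- a k))\<^sup>2)"
    by (simp only: inner Re_sum sum_distrib_left sum.distrib add.assoc)
  also have "(\<Sum>k\<in>J. 2 * Re (cnj (- a k) * ?c k) + (cmod (- a k))\<^sup>2) = (\<Sum>k\<in>J. (cmod (a k - ?c k))\<^sup>2 - (cmod (?c k))\<^sup>2)"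
    unfolding cmod_power2 by (intro sum.cong refl) (simp add: power2_eq_square algebra_simps)
  finally show ?thesis by (simp add: sum_subtractf)
qed

lemma L2_Bessel:
  assumes "finite J" "f \<in> L2"
  shows "(\<Sum>k\<in>J. (cmod (L2_inner f (fourier_basis k)))\<^sup>2) \<le> (L2_norm f)\<^sup>2"
proof -
  have "0 \<le> (L2_norm f)\<^sup>2 - (\<Sum>k\<in>J. (cmod (L2_inner f (fourier_basis k)))\<^sup>2)"
    using L2_norm_diff_trig[OF assms, of "\<lambda>k. L2_inner f (fourier_basis k)"]
      zero_le_power2[of "L2_norm (\<lambda>x. f x - (\<Sum>k\<in>J. L2_inner f (fourier_basis k) * fourier_basis k x))"]
    by simp
  then show ?thesis by simp
qed

text \<open>Density supplies some trigonometric polynomial, and over its index set the Fourier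
  coefficients do at least as well.\<close>

lemma fourier_partial_sum_approx:
  assumes f: "f \<in> L2" and "\<epsilon> > 0"
  obtains J where "finite J"
    "L2_norm (\<lambda>x. f x - (\<Sum>k\<in>J. L2_inner f (fourier_basis k) * fourier_basis k x)) < \<epsilon>"
proof -
  obtain p where p: "p \<in> trig_poly" "L2_norm (\<lambda>x. f x - p x) < \<epsilon>"
    using assms trig_poly_dense unfolding trig_closure_def by blast
  from p(1) obtain J a where J: "finite J" "p = (\<lambda>x. \<Sum>k\<in>J. a k * fourier_basis k x)"
    by (rule trig_poly_sum_form)
  have "(L2_norm (\<lambda>x. f x - (\<Sum>k\<in>J. L2_inner f (fourier_basis k) * fourier_basis k x)))\<^sup>2
      \<le> (L2_norm (\<lambda>x. f x - p x))\<^sup>2"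
    unfolding J(2) L2_norm_diff_trig[OF J(1) f] by (simp add: sum_nonneg)
  then have "L2_norm (\<lambda>x. f x - (\<Sum>k\<in>J. L2_inner f (fourier_basis k) * fourier_basis k x))
      \<le> L2_norm (\<lambda>x. f x - p x)"
    by (rule power2_le_imp_le) simp
  with p(2) J(1) show ?thesis by (intro that) auto
qed

text \<open>Bounded linear functionals. Linearity is an exact equation of numbers here, whereas
  operators are linear only up to \<open>\<doteq>\<close>. The constant \<open>C\<close> serves to
  express continuity; sharper bounds \<open>K\<close> are derived separately.\<close>

locale L2_functional =
  fixes \<phi> :: "(real \<Rightarrow> complex) \<Rightarrow> complex" and C :: real
  assumes add: "f \<in> L2 \<Longrightarrow> g \<in> L2 \<Longrightarrow> \<phi> (\<lambda>x. f x + g x) = \<phi> f + \<phi> g"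
    and cmult: "f \<in> L2 \<Longrightarrow> \<phi> (\<lambda>x. a * f x) = a * \<phi> f"
    and bounded: "f \<in> L2 \<Longrightarrow> cmod (\<phi> f) \<le> C * L2_norm f"
begin

lemma diff: "f \<in> L2 \<Longrightarrow> g \<in> L2 \<Longrightarrow> \<phi> (\<lambda>x. f x - g x) = \<phi> f - \<phi> g"
  using add[of f "\<lambda>x. -1 * g x"] cmult[of g "-1"] L2_cmult[of g "-1"] by simp

lemma lincomb:
  assumes "finite J" "\<And>i. i \<in> J \<Longrightarrow> f i \<in> L2"
  shows "\<phi> (\<lambda>x. \<Sum>i\<in>J. a i * f i x) = (\<Sum>i\<in>J. a i * \<phi> (f i))"
  using assms
proof (induction J)
  case empty
  then show ?case using cmult[of "\<lambda>x. 0" 0] by simp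
next
  case (insert i J)
  then have "\<phi> (\<lambda>x. a i * f i x + (\<Sum>i\<in>J. a i * f i x)) = \<phi> (\<lambda>x. a i * f i x) + \<phi> (\<lambda>x. \<Sum>i\<in>J. a i * f i x)"
    by (intro add L2_cmult L2_sum) auto
  with insert show ?case by (simp add: cmult)
qed

text \<open>Tested on the combination with coefficients \<open>cnj (\<phi> (b i))\<close>, whose
  norm is \<open>sqrt s\<close>, the functional takes the value \<open>s\<close>. Hence
  \<open>s \<le> K * sqrt s\<close>, and \<open>sqrt s\<close> cancels unless it is zero.\<close>

lemma sum_orthonormal_le:
  assumes "finite J" "\<And>i. i \<in> J \<Longrightarrow> b i \<in> L2"
    and "\<And>i j. i \<in> J \<Longrightarrow> j \<in> J \<Longrightarrow> L2_inner (b i) (b j) = (if i = j then 1 else 0)"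
    and K: "\<And>f. f \<in> L2 \<Longrightarrow> cmod (\<phi> f) \<le> K * L2_norm f"
  shows "(\<Sum>i\<in>J. (cmod (\<phi> (b i)))\<^sup>2) \<le> K\<^sup>2"
proof -
  define s where "s = (\<Sum>i\<in>J. (cmod (\<phi> (b i)))\<^sup>2)"
  have s0: "s \<ge> 0" unfolding s_def by (simp add: sum_nonneg)
  let ?p = "\<lambda>x. \<Sum>i\<in>J. cnj (\<phi> (b i)) * b i x"
  have p: "?p \<in> L2" using assms(2) by (intro L2_sum L2_cmult)
  have "\<phi> ?p = (\<Sum>i\<in>J. cnj (\<phi> (b i)) * \<phi> (b i))"
    using assms by (intro lincomb) auto
  also have "\<dots> = of_real s"
    unfolding s_def by (simp only: of_real_sum complex_norm_square mult.commute)
  finally have "s = cmod (\<phi> ?p)" using s0 by simp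
  also have "\<dots> \<le> K * L2_norm ?p" using p by (rule K)
  also have "L2_norm ?p = sqrt s"
    using L2_norm_orthonormal_sum[OF assms(1-3), of "\<lambda>i. cnj (\<phi> (b i))"]
    by (simp add: s_def real_sqrt_unique)
  finally have *: "s \<le> K * sqrt s" .
  have "s \<le> K\<^sup>2"
  proof (cases "s = 0")
    case False
    then have "sqrt s > 0" using s0 by simp
    moreover have "sqrt s * sqrt s \<le> K * sqrt s" using * s0 by simp
    ultimately have "sqrt s \<le> K" by (simp only: mult_le_cancel_right_pos)
    then have "(sqrt s)\<^sup>2 \<le> K\<^sup>2" using s0 by (intro power_mono) auto
    then show ?thesis using s0 by simp
  qed simp
  then show ?thesis by (simp add: s_def)
qed

text \<open>By continuity \<open>\<phi> f\<close> is approximated by \<open>\<phi>\<close> of a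
  Fourier partial sum, and the triangle inequality bounds the latter by one of the sums in the
  hypothesis. This serves both the square sums and the entries of a product of operators.\<close>

lemma norm_le_of_partial_sums:
  assumes f: "f \<in> L2"
    and B: "\<And>J. finite J \<Longrightarrow>
      (\<Sum>k\<in>J. cmod (\<phi> (fourier_basis k)) * cmod (L2_inner f (fourier_basis k))) \<le> B"
  shows "cmod (\<phi> f) \<le> B"
proof (rule field_le_epsilon)
  fix \<epsilon> :: real assume "\<epsilon> > 0"
  \<comment> \<open>No sign of \<open>C\<close> is assumed, so \<open>\<bar>C\<bar> + 1\<close>
    serves as a positive Lipschitz constant.\<close>
  then have "\<epsilon> / (\<bar>C\<bar> + 1) > 0" by simp
  from f this obtain J where J: "finite J"
    "L2_norm (\<lambda>x. f x - (\<Sum>k\<in>J. L2_inner f (fourier_basis k) * fourier_basis k x)) < \<epsilon> / (\<bar>C\<bar> + 1)"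
    by (rule fourier_partial_sum_approx)
  let ?S = "\<lambda>x. \<Sum>k\<in>J. L2_inner f (fourier_basis k) * fourier_basis k x"
  have S: "?S \<in> L2" by (intro L2_sum L2_cmult) simp
  have "cmod (\<phi> f - \<phi> ?S) = cmod (\<phi> (\<lambda>x. f x - ?S x))"
    by (simp only: diff[OF f S])
  also have "\<dots> \<le> C * L2_norm (\<lambda>x. f x - ?S x)"
    using f S by (intro bounded L2_diff)
  also have "\<dots> \<le> (\<bar>C\<bar> + 1) * L2_norm (\<lambda>x. f x - ?S x)"
    by (intro mult_right_mono) auto
  also have "\<dots> \<le> \<epsilon>"
    using J(2) by (simp add: pos_less_divide_eq mult.commute)
  finally have "cmod (\<phi> f - \<phi> ?S) \<le> \<epsilon>" .
  moreover have "cmod (\<phi> ?S) \<le> B"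
  proof -
    have "cmod (\<phi> ?S) = cmod (\<Sum>k\<in>J. L2_inner f (fourier_basis k) * \<phi> (fourier_basis k))"
      using J(1) by (subst lincomb) auto
    also have "\<dots> \<le> (\<Sum>k\<in>J. cmod (\<phi> (fourier_basis k)) * cmod (L2_inner f (fourier_basis k)))"
      by (rule order_trans[OF norm_sum]) (simp add: norm_mult mult.commute)
    finally show ?thesis using B[OF J(1)] by simp
  qed
  ultimately show "cmod (\<phi> f) \<le> B + \<epsilon>"
    using norm_triangle_ineq2[of "\<phi> f" "\<phi> ?S"] by linarith
qed

text \<open>Converse to \<open>sum_orthonormal_le\<close> for the Fourier basis, by Cauchy-Schwarz
  for finite sums and Bessel. Together they identify the sum of squares with the squared norm of the
  functional.\<close>

lemma norm_le_of_square_sums: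
  assumes K: "\<And>J. finite J \<Longrightarrow> (\<Sum>k\<in>J. (cmod (\<phi> (fourier_basis k)))\<^sup>2) \<le> K\<^sup>2" and "K \<ge> 0"
    and f: "f \<in> L2"
  shows "cmod (\<phi> f) \<le> K * L2_norm f"
proof (rule norm_le_of_partial_sums[OF f])
  fix J :: "int set" assume J: "finite J"
  let ?a = "\<lambda>k. cmod (\<phi> (fourier_basis k))" and ?c = "\<lambda>k. cmod (L2_inner f (fourier_basis k))"
  have "(\<Sum>k\<in>J. ?a k * ?c k) \<le> L2_set ?a J * L2_set ?c J"
    using L2_set_mult_ineq[of ?a ?c J] by simp
  also have "\<dots> \<le> K * L2_norm f"
    using K[OF J] L2_Bessel[OF J f] \<open>K \<ge> 0\<close>
    by (intro mult_mono) (auto simp: L2_set_def intro!: real_le_lsqrt sum_nonneg)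
  finally show "(\<Sum>k\<in>J. ?a k * ?c k) \<le> K * L2_norm f" .
qed

end

section \<open>Operators and the functionals that they induce\<close>

lemma L2_operatorD:
  assumes "L2_operator W"
  shows "\<And>f. f \<in> L2 \<Longrightarrow> W f \<in> L2"
    and "\<And>f g. f \<in> L2 \<Longrightarrow> g \<in> L2 \<Longrightarrow> f \<doteq> g \<Longrightarrow> W f \<doteq> W g"
    and "\<And>f g. f \<in> L2 \<Longrightarrow> g \<in> L2 \<Longrightarrow> W (\<lambda>x. f x + g x) \<doteq> (\<lambda>x. W f x + W g x)"
    and "\<And>a f. f \<in> L2 \<Longrightarrow> W (\<lambda>x. a * f x) \<doteq> (\<lambda>x. a * W f x)"
    and "\<exists>C. \<forall>f\<in>L2. L2_norm (W f) \<le> C * L2_norm f"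
  using assms unfolding L2_operator_def by auto

lemma L2_functional_inner:
  assumes g: "g \<in> L2"
  shows "L2_functional (\<lambda>f. L2_inner f g) (L2_norm g)"
  by standard (use g in \<open>auto simp: L2_inner_add_left L2_inner_cmult_left
    intro!: L2_Cauchy_Schwarz[THEN order_trans]\<close>)

lemma L2_functional_operator:
  assumes W: "L2_operator W" and g: "g \<in> L2"
  obtains C where "L2_functional (\<lambda>f. L2_inner (W f) g) C"
proof -
  obtain C where C: "\<And>f. f \<in> L2 \<Longrightarrow> L2_norm (W f) \<le> C * L2_norm f"
    using L2_operatorD(5)[OF W] by blast
  note L2 = L2_operatorD(1)[OF W]
  have "L2_functional (\<lambda>f. L2_inner (W f) g) (C * L2_norm g)"
  proof
    fix f h assume fh: "f \<in> L2" "h \<in> L2"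
    have "L2_inner (W (\<lambda>x. f x + h x)) g = L2_inner (\<lambda>x. W f x + W h x) g"
      using fh g by (intro L2_inner_cong_left L2_operatorD(3)[OF W] L2 L2_add)
    then show "L2_inner (W (\<lambda>x. f x + h x)) g = L2_inner (W f) g + L2_inner (W h) g"
      using fh g by (simp add: L2_inner_add_left L2)
  next
    fix f a assume f: "f \<in> L2"
    have "L2_inner (W (\<lambda>x. a * f x)) g = L2_inner (\<lambda>x. a * W f x) g"
      using f g by (intro L2_inner_cong_left L2_operatorD(4)[OF W] L2 L2_cmult)
    then show "L2_inner (W (\<lambda>x. a * f x)) g = a * L2_inner (W f) g"
      by (simp add: L2_inner_cmult_left)
  next
    fix f assume f: "f \<in> L2"
    have "cmod (L2_inner (W f) g) \<le> L2_norm (W f) * L2_norm g"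
      using f g by (intro L2_Cauchy_Schwarz L2)
    also have "\<dots> \<le> (C * L2_norm f) * L2_norm g"
      by (intro mult_right_mono C f) simp
    finally show "cmod (L2_inner (W f) g) \<le> C * L2_norm g * L2_norm f"
      by (simp add: mult_ac)
  qed
  then show ?thesis by (rule that)
qed

lemma unitary_operatorD:
  assumes "unitary_operator U"
  shows "L2_operator U"
    and "\<And>f g. f \<in> L2 \<Longrightarrow> g \<in> L2 \<Longrightarrow> L2_inner (U f) (U g) = L2_inner f g"
    and "\<And>g. g \<in> L2 \<Longrightarrow> \<exists>f\<in>L2. U f \<doteq> g"
  using assms unfolding unitary_operator_def by auto

lemma unitary_L2_norm:
  assumes "unitary_operator U" "f \<in> L2"
  shows "L2_norm (U f) = L2_norm f"
proof -
  have "complex_of_real ((L2_norm (U f))\<^sup>2) = of_real ((L2_norm f)\<^sup>2)"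
    using assms unitary_operatorD(2)[of U f f] by (simp only: flip: L2_inner_self)
  then have "(L2_norm (U f))\<^sup>2 = (L2_norm f)\<^sup>2" by (simp only: of_real_eq_iff)
  then show ?thesis by (simp add: power2_eq_iff_nonneg)
qed

section \<open>Sums in \<open>[0, \<infinity>]\<close> as integrals over counting measure\<close>

text \<open>Both sides are suprema of finite partial sums; countability provides an increasing
  exhaustion by finite sets for monotone convergence. The integral form gives access to Tonelli's
  theorem and dominated convergence.\<close>

lemma infsum_ennreal_eq_nn_integral:
  fixes f :: "'a \<Rightarrow> ennreal"
  assumes "countable A"
  shows "infsum f A = (\<integral>\<^sup>+x. f x \<partial>count_space A)"
proof (rule antisym)
  have eq: "sum f F = (\<integral>\<^sup>+x. f x * indicator F x \<partial>count_space A)" if "finite F" "F \<subseteq> A" for F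
    using that by (subst nn_integral_count_space'[of F]) (auto simp: indicator_def)
  have inf: "infsum f A = (SUP F\<in>{F. finite F \<and> F \<subseteq> A}. sum f F)"
    by (rule nonneg_infsum_complete) simp
  show "infsum f A \<le> (\<integral>\<^sup>+x. f x \<partial>count_space A)"
    unfolding inf by (rule SUP_least) (auto simp: eq indicator_def intro!: nn_integral_mono)
  show "(\<integral>\<^sup>+x. f x \<partial>count_space A) \<le> infsum f A"
  proof (cases "A = {}")
    case False
    define F where "F n = from_nat_into A ` {..n}" for n
    have F: "finite (F n)" "F n \<subseteq> A" for n
      using from_nat_into[OF False] by (auto simp: F_def)
    have inc: "incseq F" by (auto simp: F_def incseq_def)
    have "(\<integral>\<^sup>+x. f x \<partial>count_space A) = (\<integral>\<^sup>+x. (SUP n. f x * indicator (F n) x) \<partial>count_space A)"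
    proof (rule nn_integral_cong)
      fix x assume "x \<in> space (count_space A)"
      then obtain n where "x \<in> F n"
        using assms by (auto simp: F_def dest!: from_nat_into_surj)
      then show "f x = (SUP n. f x * indicator (F n) x)"
        by (intro antisym SUP_upper2[of n] SUP_least) (auto simp: indicator_def)
    qed
    also have "\<dots> = (SUP n. \<integral>\<^sup>+x. f x * indicator (F n) x \<partial>count_space A)"
      using inc by (intro nn_integral_monotone_convergence_SUP)
        (auto simp: incseq_def le_fun_def indicator_def)
    also have "\<dots> \<le> infsum f A"
      unfolding inf using F by (intro SUP_mono) (auto simp: eq[symmetric] intro!: exI[of _ "F _"])
    finally show ?thesis .
  qed (simp add: nn_integral_empty)
qed

lemma nn_integral_count_space_le_iff:
  fixes x :: "'a::countable \<Rightarrow> real"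
  assumes "\<And>i. x i \<ge> 0" "B \<ge> 0"
  shows "(\<integral>\<^sup>+i. ennreal (x i) \<partial>count_space UNIV) \<le> ennreal B \<longleftrightarrow> (\<forall>J. finite J \<longrightarrow> sum x J \<le> B)"
proof -
  have "(\<integral>\<^sup>+i. ennreal (x i) \<partial>count_space UNIV) = (SUP F\<in>{F. finite F}. \<Sum>i\<in>F. ennreal (x i))"
    using infsum_ennreal_eq_nn_integral[of UNIV "\<lambda>i. ennreal (x i)"]
    by (simp add: nonneg_infsum_complete)
  then show ?thesis
    using assms by (auto simp: SUP_le_iff sum_ennreal sum_nonneg)
qed

text \<open>Reduces an inequality between possibly infinite sums to the transfer of finite bounds.
  They are written as squares to match bounds on the norm of a functional; an infinite right-hand
  side is trivial.\<close>

lemma nn_integral_count_space_mono_squares: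
  fixes x y :: "'a::countable \<Rightarrow> real"
  assumes "\<And>i. x i \<ge> 0" "\<And>i. y i \<ge> 0"
    and imp: "\<And>K. K \<ge> 0 \<Longrightarrow> (\<And>J. finite J \<Longrightarrow> sum y J \<le> K\<^sup>2) \<Longrightarrow> (\<And>J. finite J \<Longrightarrow> sum x J \<le> K\<^sup>2)"
  shows "(\<integral>\<^sup>+i. ennreal (x i) \<partial>count_space UNIV) \<le> (\<integral>\<^sup>+i. ennreal (y i) \<partial>count_space UNIV)"
proof (cases "\<integral>\<^sup>+i. ennreal (y i) \<partial>count_space UNIV")
  case (real r)
  then have r: "(sqrt r)\<^sup>2 = r" by simp
  have "sum y J \<le> (sqrt r)\<^sup>2" if "finite J" for J
    using nn_integral_count_space_le_iff[of y r] assms(2) real that r by auto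
  then have "sum x J \<le> (sqrt r)\<^sup>2" if "finite J" for J
    using imp[of "sqrt r" J] real that by simp
  then show ?thesis
    using nn_integral_count_space_le_iff[of x r] assms(1) real r by auto
qed simp

text \<open>One inequality is Bessel. For the other, if the sum is \<open>r\<close>, then the
  functional \<open>\<lambda>g. L2_inner g f\<close> has norm at most \<open>sqrt r\<close>, and its
  value at \<open>f\<close> is the squared norm of \<open>f\<close>.\<close>

lemma L2_Parseval:
  assumes f: "f \<in> L2"
  shows "(\<integral>\<^sup>+k. ennreal ((cmod (L2_inner f (fourier_basis k)))\<^sup>2) \<partial>count_space UNIV) = ennreal ((L2_norm f)\<^sup>2)"
    (is "?I = _")
proof (rule antisym)
  show le: "?I \<le> ennreal ((L2_norm f)\<^sup>2)"
    by (subst nn_integral_count_space_le_iff) (auto intro: L2_Bessel f)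
  show "ennreal ((L2_norm f)\<^sup>2) \<le> ?I"
  proof (cases ?I)
    case (real r)
    interpret L2_functional "\<lambda>g. L2_inner g f" "L2_norm f"
      using f by (rule L2_functional_inner)
    have "(\<Sum>k\<in>J. (cmod (L2_inner (fourier_basis k) f))\<^sup>2) \<le> (sqrt r)\<^sup>2" if "finite J" for J
    proof -
      have "cmod (L2_inner (fourier_basis k) f) = cmod (L2_inner f (fourier_basis k))" for k
        by (subst L2_inner_commute) simp
      then show ?thesis
        using nn_integral_count_space_le_iff[of "\<lambda>k. (cmod (L2_inner f (fourier_basis k)))\<^sup>2" r] real that
        by simp
    qed
    from norm_le_of_square_sums[OF this _ f]
    have "(L2_norm f)\<^sup>2 \<le> sqrt r * L2_norm f"
      using real by (simp add: L2_inner_self norm_power)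
    then have "L2_norm f \<le> sqrt r"
      using L2_norm_nonneg[of f] real by (cases "L2_norm f = 0") (auto simp: power2_eq_square)
    then have "(L2_norm f)\<^sup>2 \<le> r"
      using power_mono[of "L2_norm f" "sqrt r" 2] real by simp
    with real show ?thesis by simp
  qed simp
qed

section \<open>Row and column sums of matrices\<close>

definition row_mass :: "L2_map \<Rightarrow> int \<Rightarrow> ennreal" where
  "row_mass W l = (\<integral>\<^sup>+j. ennreal ((cmod (matrix_entry W l j))\<^sup>2) \<partial>count_space UNIV)"

definition column_mass :: "L2_map \<Rightarrow> int \<Rightarrow> ennreal" where
  "column_mass W j = (\<integral>\<^sup>+l. ennreal ((cmod (matrix_entry W l j))\<^sup>2) \<partial>count_space UNIV)"

lemma row_mass_comp_unitary:
  assumes W: "L2_operator W" and U: "unitary_operator U"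
  shows "row_mass (W \<circ> U) l = row_mass W l"
proof -
  define \<phi> where "\<phi> f = L2_inner (W f) (fourier_basis l)" for f
  obtain C where "L2_functional \<phi> C"
    unfolding \<phi>_def using L2_functional_operator[OF W] by (metis fourier_basis_L2)
  then interpret \<phi>: L2_functional \<phi> C .
  note UL2 = L2_operatorD(1)[OF unitary_operatorD(1)[OF U]]
    and UN = unitary_L2_norm[OF U]
  have cong: "\<phi> f = \<phi> g" if "f \<doteq> g" "f \<in> L2" "g \<in> L2" for f g
    unfolding \<phi>_def using that
    by (intro L2_inner_cong_left L2_operatorD[OF W]) auto
  interpret \<psi>: L2_functional "\<lambda>f. \<phi> (U f)" C
  proof
    fix f g assume fg: "f \<in> L2" "g \<in> L2"
    have "\<phi> (U (\<lambda>x. f x + g x)) = \<phi> (\<lambda>x. U f x + U g x)"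
      using fg by (intro cong L2_operatorD(3)[OF unitary_operatorD(1)[OF U]] UL2 L2_add)
    then show "\<phi> (U (\<lambda>x. f x + g x)) = \<phi> (U f) + \<phi> (U g)"
      using fg by (simp add: \<phi>.add UL2)
  next
    fix f a assume f: "f \<in> L2"
    have "\<phi> (U (\<lambda>x. a * f x)) = \<phi> (\<lambda>x. a * U f x)"
      using f by (intro cong L2_operatorD(4)[OF unitary_operatorD(1)[OF U]] UL2 L2_cmult)
    then show "\<phi> (U (\<lambda>x. a * f x)) = a * \<phi> (U f)"
      using f by (simp add: \<phi>.cmult UL2)
  next
    fix f assume f: "f \<in> L2"
    then show "cmod (\<phi> (U f)) \<le> C * L2_norm f"
      using \<phi>.bounded[OF UL2[OF f]] by (simp add: UN)
  qed
  \<comment> \<open>The row of \<open>W\<close> bounds the norm of \<open>\<phi>\<close> by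
    \<open>K\<close>, which is then tested on the orthonormal family
    \<open>U (fourier_basis j)\<close>.\<close>
  have "(\<Sum>j\<in>J. (cmod (\<phi> (U (fourier_basis j))))\<^sup>2) \<le> K\<^sup>2"
    if "K \<ge> 0" "\<And>J. finite J \<Longrightarrow> (\<Sum>j\<in>J. (cmod (\<phi> (fourier_basis j)))\<^sup>2) \<le> K\<^sup>2" "finite J" for J K
    using UL2
    by (rule_tac \<phi>.sum_orthonormal_le[OF that(3) _ _ \<phi>.norm_le_of_square_sums[OF that(2,1)]])
       (simp_all add: unitary_operatorD(2)[OF U] fourier_basis_orthonormal)
  moreover have "(\<Sum>j\<in>J. (cmod (\<phi> (fourier_basis j)))\<^sup>2) \<le> K\<^sup>2"
    if "K \<ge> 0" "\<And>J. finite J \<Longrightarrow> (\<Sum>j\<in>J. (cmod (\<phi> (U (fourier_basis j))))\<^sup>2) \<le> K\<^sup>2" "finite J" for J K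
  proof (rule \<phi>.sum_orthonormal_le[OF that(3)])
    fix g assume g: "g \<in> L2"
    then obtain f where f: "f \<in> L2" "U f \<doteq> g"
      using unitary_operatorD(3)[OF U] by blast
    \<comment> \<open>The row of \<open>W \<circ> U\<close> bounds \<open>\<phi>\<close> on the
      range of \<open>U\<close>; surjectivity of \<open>U\<close> makes this a bound on all of
      \<open>L2\<close>.\<close>
    have "cmod (\<phi> (U f)) \<le> K * L2_norm (U f)"
      using \<psi>.norm_le_of_square_sums[of K f] that f(1) UN by simp
    then show "cmod (\<phi> g) \<le> K * L2_norm g"
      using cong[OF f(2) UL2 g] L2_norm_cong[OF f(2) UL2 g] f(1) by simp
  qed (auto simp: fourier_basis_orthonormal)
  ultimately show ?thesis
    unfolding row_mass_def matrix_entry_def o_def \<phi>_def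
    by (intro antisym nn_integral_count_space_mono_squares) auto
qed

lemma column_mass_unitary_comp:
  assumes W: "L2_operator W" and U: "unitary_operator U"
  shows "column_mass (U \<circ> W) j = column_mass W j"
proof -
  have We: "W (fourier_basis j) \<in> L2"
    using L2_operatorD(1)[OF W] by simp
  then have "U (W (fourier_basis j)) \<in> L2"
    by (rule L2_operatorD(1)[OF unitary_operatorD(1)[OF U]])
  with We show ?thesis
    by (simp add: column_mass_def matrix_entry_def L2_Parseval unitary_L2_norm[OF U])
qed

text \<open>\<open>W (fourier_basis j)\<close> is expanded in the basis inside the functional of row
  \<open>l\<close> of \<open>U\<close>. An inequality of absolute values suffices for the decay of
  the diagonals and spares the summation of the product series.\<close>

lemma matrix_entry_comp_le:
  assumes W: "L2_operator W" and U: "L2_operator U"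
  shows "ennreal (cmod (matrix_entry (U \<circ> W) l j))
    \<le> (\<integral>\<^sup>+k. ennreal (cmod (matrix_entry U l k)) * ennreal (cmod (matrix_entry W k j)) \<partial>count_space UNIV)"
    (is "_ \<le> ?I")
proof (cases ?I)
  case (real r)
  obtain C where "L2_functional (\<lambda>f. L2_inner (U f) (fourier_basis l)) C"
    using L2_functional_operator[OF U] by (metis fourier_basis_L2)
  then interpret L2_functional "\<lambda>f. L2_inner (U f) (fourier_basis l)" C .
  have "(\<Sum>k\<in>J. cmod (matrix_entry U l k) * cmod (matrix_entry W k j)) \<le> r" if "finite J" for J
    using nn_integral_count_space_le_iff[of "\<lambda>k. cmod (matrix_entry U l k) * cmod (matrix_entry W k j)" r]
      real that by (simp add: ennreal_mult)
  then have "cmod (matrix_entry (U \<circ> W) l j) \<le> r"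
    using norm_le_of_partial_sums[of "W (fourier_basis j)" r] L2_operatorD(1)[OF W]
    by (simp add: matrix_entry_def)
  then show ?thesis using real by (simp add: ennreal_leI)
qed simp

section \<open>Comparison of row and column sums over intervals\<close>

lemma interval_mean_eq_row_mass:
  "interval_mean W n m = (\<Sum>l\<in>{n..m}. row_mass W l) / of_nat (card {n..m})"
proof -
  let ?f = "\<lambda>(j, l). ennreal ((cmod (matrix_entry W l j))\<^sup>2)"
  have "infsum ?f (UNIV \<times> {n..m}) = (\<integral>\<^sup>+p. ?f p \<partial>count_space (UNIV \<times> {n..m}))"
    by (rule infsum_ennreal_eq_nn_integral) simp
  also have "\<dots> = (\<integral>\<^sup>+p. ?f p * indicator (UNIV \<times> {n..m}) p \<partial>count_space UNIV)"
    by (rule nn_integral_count_space_indicator) simp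
  also have "\<dots> = (\<integral>\<^sup>+l. \<integral>\<^sup>+j. ?f (j, l) * indicator (UNIV \<times> {n..m}) (j, l) \<partial>count_space UNIV \<partial>count_space UNIV)"
    by (rule nn_integral_snd_count_space[symmetric])
  also have "\<dots> = (\<integral>\<^sup>+l. row_mass W l * indicator {n..m} l \<partial>count_space UNIV)"
    by (intro nn_integral_cong) (auto simp: row_mass_def indicator_def)
  also have "\<dots> = (\<integral>\<^sup>+l. row_mass W l \<partial>count_space {n..m})"
    by (rule nn_integral_count_space_indicator[symmetric]) simp
  also have "\<dots> = (\<Sum>l\<in>{n..m}. row_mass W l)"
    by (simp add: nn_integral_count_space_finite)
  finally show ?thesis by (simp add: interval_mean_def)
qed

text \<open>
  On the diagonal \<open>l - j = k\<close>, at most \<open>min(|k|, N)\<close> of the entries in the rows (or in the columns)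
  of an interval of length \<open>N\<close> have their other index outside the interval.
\<close>

definition edge_mass :: "L2_map \<Rightarrow> nat \<Rightarrow> ennreal" where
  "edge_mass W N =
     (\<integral>\<^sup>+k. (diag_sup W k)\<^sup>2 * ennreal (min 1 (\<bar>real_of_int k\<bar> / real N)) \<partial>count_space UNIV)"

lemma matrix_entry_le_diag_sup: "ennreal ((cmod (matrix_entry W l j))\<^sup>2) \<le> (diag_sup W (l - j))\<^sup>2"
proof -
  have "ennreal (cmod (matrix_entry W l j)) \<le> diag_sup W (l - j)"
    unfolding diag_sup_def by (rule SUP_upper2[of j]) auto
  then have "(ennreal (cmod (matrix_entry W l j)))\<^sup>2 \<le> (diag_sup W (l - j))\<^sup>2"
    by (rule power_mono) simp
  then show ?thesis by (simp add: ennreal_power)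
qed

lemma card_shift_outside_interval:
  fixes n m k :: int
  assumes "n \<le> m"
  shows "(\<Sum>l\<in>{n..m}. indicator (- {n..m}) (l + k))
    \<le> of_nat (card {n..m}) * ennreal (min 1 (\<bar>real_of_int k\<bar> / real (card {n..m})))"
proof -
  let ?S = "{l \<in> {n..m}. l + k \<notin> {n..m}}"
  define c where "c = card {n..m}"
  have pos: "c > 0" using assms by (simp add: c_def)
  \<comment> \<open>A shift by \<open>k\<close> leaves the interval only from its first
    \<open>-k\<close> or its last \<open>k\<close> points; the sign of \<open>k\<close> decides
    which of the two pieces is empty.\<close>
  have "?S \<subseteq> {n..<n - k} \<union> {m - k<..m}" by auto
  then have "card ?S \<le> card ({n..<n - k} \<union> {m - k<..m})" by (intro card_mono) auto
  also have "\<dots> \<le> nat k + nat (- k)"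
    by (rule order_trans[OF card_Un_le]) simp
  finally have "real (card ?S) \<le> \<bar>real_of_int k\<bar>" by linarith
  moreover have "card ?S \<le> c" unfolding c_def by (intro card_mono) auto
  ultimately have "real (card ?S) \<le> real c * min 1 (\<bar>real_of_int k\<bar> / real c)"
    using pos by (auto simp: min_def)
  then have "ennreal (real (card ?S)) \<le> ennreal (real c * min 1 (\<bar>real_of_int k\<bar> / real c))"
    by (rule ennreal_leI)
  also have "\<dots> = of_nat c * ennreal (min 1 (\<bar>real_of_int k\<bar> / real c))"
    by (subst ennreal_mult) (auto simp: ennreal_of_nat_eq_real_of_nat)
  also have "ennreal (real (card ?S)) = (\<Sum>l\<in>{n..m}. indicator (- {n..m}) (l + k))"
    by (simp add: indicator_def sum.If_cases ennreal_of_nat_eq_real_of_nat Int_def)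
  finally show ?thesis by (simp only: c_def)
qed

text \<open>The map \<open>g\<close> stands for negation or the identity: on diagonal
  \<open>k\<close>, row \<open>l\<close> meets column \<open>l - k\<close>, while column
  \<open>j\<close> meets row \<open>j + k\<close>.\<close>

lemma weighted_card_shift_outside_interval:
  fixes n m :: int
  assumes "n \<le> m" and g: "\<And>k. \<bar>g k\<bar> = \<bar>k\<bar>"
  shows "(\<Sum>l\<in>{n..m}. \<integral>\<^sup>+k. (diag_sup W k)\<^sup>2 * indicator (- {n..m}) (l + g k) \<partial>count_space UNIV)
    \<le> of_nat (card {n..m}) * edge_mass W (card {n..m})"
proof -
  have abs: "\<bar>real_of_int (g k)\<bar> = \<bar>real_of_int k\<bar>" for k
    using g[of k] by linarith
  have "(\<Sum>l\<in>{n..m}. \<integral>\<^sup>+k. (diag_sup W k)\<^sup>2 * indicator (- {n..m}) (l + g k) \<partial>count_space UNIV)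
     = (\<integral>\<^sup>+k. (\<Sum>l\<in>{n..m}. (diag_sup W k)\<^sup>2 * indicator (- {n..m}) (l + g k)) \<partial>count_space UNIV)"
    by (rule nn_integral_sum[symmetric]) simp
  also have "\<dots> \<le> (\<integral>\<^sup>+k. of_nat (card {n..m}) * ((diag_sup W k)\<^sup>2
      * ennreal (min 1 (\<bar>real_of_int k\<bar> / real (card {n..m})))) \<partial>count_space UNIV)"
  proof (rule nn_integral_mono)
    fix k
    show "(\<Sum>l\<in>{n..m}. (diag_sup W k)\<^sup>2 * indicator (- {n..m}) (l + g k))
      \<le> of_nat (card {n..m}) * ((diag_sup W k)\<^sup>2
        * ennreal (min 1 (\<bar>real_of_int k\<bar> / real (card {n..m}))))"
      using mult_left_mono[OF card_shift_outside_interval[OF assms(1), of "g k"], of "(diag_sup W k)\<^sup>2"]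
      by (simp only: abs sum_distrib_left mult.left_commute zero_le)
  qed
  also have "\<dots> = of_nat (card {n..m}) * edge_mass W (card {n..m})"
    unfolding edge_mass_def by (rule nn_integral_cmult) simp
  finally show ?thesis .
qed

text \<open>The square block with both indices in the interval is common to the row sums and the
  column sums, so only entries with the other index outside remain. Applied to the squared entries
  and to their transpose.\<close>

lemma sum_interval_split_le:
  fixes x :: "int \<Rightarrow> int \<Rightarrow> ennreal" and n m :: int
  shows "(\<Sum>l\<in>{n..m}. \<integral>\<^sup>+j. x l j \<partial>count_space UNIV)
    \<le> (\<Sum>j\<in>{n..m}. \<integral>\<^sup>+l. x l j \<partial>count_space UNIV)
      + (\<Sum>l\<in>{n..m}. \<integral>\<^sup>+j. x l j * indicator (- {n..m}) j \<partial>count_space UNIV)"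
proof -
  have fin: "(\<integral>\<^sup>+j. y j * indicator {n..m} j \<partial>count_space UNIV) = (\<Sum>j\<in>{n..m}. y j)" for y :: "int \<Rightarrow> ennreal"
    by (subst nn_integral_count_space_indicator[symmetric]) (simp_all add: nn_integral_count_space_finite)
  have "(\<Sum>l\<in>{n..m}. \<integral>\<^sup>+j. x l j \<partial>count_space UNIV)
      = (\<Sum>l\<in>{n..m}. \<integral>\<^sup>+j. (x l j * indicator {n..m} j + x l j * indicator (- {n..m}) j) \<partial>count_space UNIV)"
    by (intro sum.cong nn_integral_cong) (auto simp: indicator_def)
  also have "\<dots> = (\<Sum>l\<in>{n..m}. \<Sum>j\<in>{n..m}. x l j)
      + (\<Sum>l\<in>{n..m}. \<integral>\<^sup>+j. x l j * indicator (- {n..m}) j \<partial>count_space UNIV)"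
    by (simp add: nn_integral_add fin sum.distrib)
  also have "(\<Sum>l\<in>{n..m}. \<Sum>j\<in>{n..m}. x l j) = (\<Sum>j\<in>{n..m}. \<Sum>l\<in>{n..m}. x l j)"
    by (rule sum.swap)
  also have "\<dots> \<le> (\<Sum>j\<in>{n..m}. \<integral>\<^sup>+l. x l j \<partial>count_space UNIV)"
  proof (rule sum_mono)
    fix j
    show "(\<Sum>l\<in>{n..m}. x l j) \<le> (\<integral>\<^sup>+l. x l j \<partial>count_space UNIV)"
      unfolding fin[symmetric] by (intro nn_integral_mono) (auto simp: indicator_def)
  qed
  finally show ?thesis by (simp add: add_right_mono)
qed

text \<open>Reindexing by the diagonal \<open>k = l - j\<close>; the spelling \<open>l + - k\<close>
  matches the pattern \<open>l + g k\<close> of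
  \<open>weighted_card_shift_outside_interval\<close>.\<close>

lemma nn_integral_row_shift_le:
  "(\<integral>\<^sup>+j. ennreal ((cmod (matrix_entry W l j))\<^sup>2) * indicator A j \<partial>count_space UNIV)
    \<le> (\<integral>\<^sup>+k. (diag_sup W k)\<^sup>2 * indicator A (l + - k) \<partial>count_space UNIV)"
proof -
  have "bij_betw (\<lambda>k. l + - k) UNIV UNIV"
    by (rule bij_betw_byWitness[of _ "\<lambda>k. l - k"]) auto
  then have "(\<integral>\<^sup>+j. ennreal ((cmod (matrix_entry W l j))\<^sup>2) * indicator A j \<partial>count_space UNIV)
    = (\<integral>\<^sup>+k. ennreal ((cmod (matrix_entry W l (l + - k)))\<^sup>2) * indicator A (l + - k) \<partial>count_space UNIV)"
    by (rule nn_integral_bij_count_space[symmetric])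
  also have "\<dots> \<le> (\<integral>\<^sup>+k. (diag_sup W k)\<^sup>2 * indicator A (l + - k) \<partial>count_space UNIV)"
  proof (intro nn_integral_mono mult_right_mono)
    show "ennreal ((cmod (matrix_entry W l (l + - k)))\<^sup>2) \<le> (diag_sup W k)\<^sup>2" for k
      using matrix_entry_le_diag_sup[of W l "l + - k"] by simp
  qed simp
  finally show ?thesis .
qed

lemma nn_integral_column_shift_le:
  "(\<integral>\<^sup>+l. ennreal ((cmod (matrix_entry W l j))\<^sup>2) * indicator A l \<partial>count_space UNIV)
    \<le> (\<integral>\<^sup>+k. (diag_sup W k)\<^sup>2 * indicator A (j + k) \<partial>count_space UNIV)"
proof -
  have "bij_betw (\<lambda>k. j + k) UNIV UNIV"
    by (rule bij_betw_byWitness[of _ "\<lambda>k. k - j"]) auto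
  then have "(\<integral>\<^sup>+l. ennreal ((cmod (matrix_entry W l j))\<^sup>2) * indicator A l \<partial>count_space UNIV)
    = (\<integral>\<^sup>+k. ennreal ((cmod (matrix_entry W (j + k) j))\<^sup>2) * indicator A (j + k) \<partial>count_space UNIV)"
    by (rule nn_integral_bij_count_space[symmetric])
  also have "\<dots> \<le> (\<integral>\<^sup>+k. (diag_sup W k)\<^sup>2 * indicator A (j + k) \<partial>count_space UNIV)"
  proof (intro nn_integral_mono mult_right_mono)
    show "ennreal ((cmod (matrix_entry W (j + k) j))\<^sup>2) \<le> (diag_sup W k)\<^sup>2" for k
      using matrix_entry_le_diag_sup[of W "j + k" j] by simp
  qed simp
  finally show ?thesis .
qed

lemma row_sum_le_column_sum:
  fixes n m :: int
  assumes "n \<le> m"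
  shows "(\<Sum>l\<in>{n..m}. row_mass W l)
    \<le> (\<Sum>j\<in>{n..m}. column_mass W j) + of_nat (card {n..m}) * edge_mass W (card {n..m})"
  unfolding row_mass_def column_mass_def
  by (rule order_trans[OF sum_interval_split_le])
     (intro add_left_mono
        order_trans[OF sum_mono[OF nn_integral_row_shift_le] weighted_card_shift_outside_interval];
      simp add: assms)

lemma column_sum_le_row_sum:
  fixes n m :: int
  assumes "n \<le> m"
  shows "(\<Sum>j\<in>{n..m}. column_mass W j)
    \<le> (\<Sum>l\<in>{n..m}. row_mass W l) + of_nat (card {n..m}) * edge_mass W (card {n..m})"
  unfolding row_mass_def column_mass_def
  by (rule order_trans[OF sum_interval_split_le[of "\<lambda>j l. ennreal ((cmod (matrix_entry W l j))\<^sup>2)"]])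
     (intro add_left_mono order_trans[OF sum_mono[OF nn_integral_column_shift_le]
        weighted_card_shift_outside_interval[where g = "\<lambda>k. k"]]; simp add: assms)

section \<open>Vanishing of the edge contribution\<close>

lemma diag_sup_square_summable:
  assumes "(\<integral>\<^sup>+k. diag_sup W k \<partial>count_space UNIV) < \<infinity>"
  shows "(\<integral>\<^sup>+k. (diag_sup W k)\<^sup>2 \<partial>count_space UNIV) < \<infinity>"
proof -
  let ?S = "\<integral>\<^sup>+k. diag_sup W k \<partial>count_space UNIV"
  have "diag_sup W k \<le> ?S" for k
    by (rule nn_integral_ge_point) simp
  then have "(\<integral>\<^sup>+k. (diag_sup W k)\<^sup>2 \<partial>count_space UNIV) \<le> (\<integral>\<^sup>+k. ?S * diag_sup W k \<partial>count_space UNIV)"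
    by (intro nn_integral_mono) (auto simp: power2_eq_square intro!: mult_right_mono)
  also have "\<dots> = ?S * ?S" by (rule nn_integral_cmult) simp
  also have "\<dots> < \<infinity>" using assms by (simp add: ennreal_mult_less_top)
  finally show ?thesis .
qed

text \<open>Dominated convergence: for fixed \<open>k\<close> the weight tends to 0, and the
  summable squares of \<open>diag_sup W\<close> dominate.\<close>

lemma edge_mass_tendsto_0:
  assumes "(\<integral>\<^sup>+k. diag_sup W k \<partial>count_space UNIV) < \<infinity>"
  shows "edge_mass W \<longlonglongrightarrow> 0"
proof -
  note sq = diag_sup_square_summable[OF assms]
  have "(\<lambda>N. edge_mass W N) \<longlonglongrightarrow> (\<integral>\<^sup>+k. 0 \<partial>count_space (UNIV :: int set))"
    unfolding edge_mass_def
  proof (rule nn_integral_dominated_convergence)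
    show "(\<integral>\<^sup>+k. (diag_sup W k)\<^sup>2 \<partial>count_space UNIV) < \<infinity>" by (rule sq)
    show "AE k in count_space UNIV. (diag_sup W k)\<^sup>2 * ennreal (min 1 (\<bar>real_of_int k\<bar> / real N))
        \<le> (diag_sup W k)\<^sup>2" for N
    proof (rule AE_I2)
      fix k :: int
      have "(diag_sup W k)\<^sup>2 * ennreal (min 1 (\<bar>real_of_int k\<bar> / real N)) \<le> (diag_sup W k)\<^sup>2 * 1"
        by (intro mult_left_mono) (auto simp: ennreal_le_1)
      then show "(diag_sup W k)\<^sup>2 * ennreal (min 1 (\<bar>real_of_int k\<bar> / real N)) \<le> (diag_sup W k)\<^sup>2"
        by simp
    qed
    show "AE k in count_space UNIV.
        (\<lambda>N. (diag_sup W k)\<^sup>2 * ennreal (min 1 (\<bar>real_of_int k\<bar> / real N))) \<longlonglongrightarrow> 0"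
    proof (rule AE_I2)
      fix k :: int
      have "(\<lambda>N. \<bar>real_of_int k\<bar> / real N) \<longlonglongrightarrow> 0"
        by (rule lim_const_over_n)
      then have "(\<lambda>N. min 1 (\<bar>real_of_int k\<bar> / real N)) \<longlonglongrightarrow> min 1 0"
        by (intro tendsto_intros)
      then have "(\<lambda>N. ennreal (min 1 (\<bar>real_of_int k\<bar> / real N))) \<longlonglongrightarrow> ennreal 0"
        by (intro tendsto_ennrealI) simp
      \<comment> \<open>In \<open>[0, \<infinity>]\<close> multiplication by a fixed factor
        preserves the limit 0 only if the factor is finite.\<close>
      moreover have "(diag_sup W k)\<^sup>2 < \<infinity>"
        using nn_integral_ge_point[of k UNIV "\<lambda>k. (diag_sup W k)\<^sup>2"] sq by (simp add: order_le_less_trans)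
      ultimately have "(\<lambda>N. (diag_sup W k)\<^sup>2 * ennreal (min 1 (\<bar>real_of_int k\<bar> / real N)))
          \<longlonglongrightarrow> (diag_sup W k)\<^sup>2 * ennreal 0"
        by (intro ennreal_tendsto_cmult) simp_all
      then show "(\<lambda>N. (diag_sup W k)\<^sup>2 * ennreal (min 1 (\<bar>real_of_int k\<bar> / real N))) \<longlonglongrightarrow> 0"
        by simp
    qed
  qed simp_all
  then show ?thesis by simp
qed

text \<open>At \<open>N = 0\<close> division by zero makes every weight 0, hence the restriction to
  positive \<open>N\<close>.\<close>

lemma edge_mass_antimono:
  assumes "0 < N" "N \<le> M"
  shows "edge_mass W M \<le> edge_mass W N"
  unfolding edge_mass_def
  using assms by (intro nn_integral_mono mult_left_mono ennreal_leI min.mono divide_left_mono) auto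

section \<open>Comparison of the limits\<close>

lemma mean_limsup_LIMSEQ:
  "(\<lambda>N. SUP (n, m) \<in> {(n, m). n \<le> m \<and> N \<le> card {n..m}}. interval_mean W n m) \<longlonglongrightarrow> mean_limsup W"
proof -
  have "decseq (\<lambda>N. SUP (n, m) \<in> {(n, m). n \<le> m \<and> N \<le> card {n..m}}. interval_mean W n m)"
    unfolding decseq_def by (intro allI impI SUP_subset_mono) auto
  from LIMSEQ_INF[OF this] show ?thesis
    unfolding mean_limsup_def by (simp add: limI)
qed

text \<open>Over each interval the rows of \<open>V\<close> are compared with its columns, these
  with the columns of \<open>W\<close>, and these with the rows of \<open>W\<close>. The first and
  last passages each cost one edge mass, which vanishes in the limit. The hypotheses are symmetric
  in \<open>V\<close> and \<open>W\<close>, so equality follows by exchanging them.\<close>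

lemma mean_limsup_le_of_column_mass_eq:
  assumes "(\<integral>\<^sup>+k. diag_sup V k \<partial>count_space UNIV) < \<infinity>"
    and "(\<integral>\<^sup>+k. diag_sup W k \<partial>count_space UNIV) < \<infinity>"
    and col: "\<And>j. column_mass V j = column_mass W j"
  shows "mean_limsup V \<le> mean_limsup W"
proof -
  let ?s = "\<lambda>W N. SUP (n, m) \<in> {(n, m). n \<le> m \<and> N \<le> card {n..m}}. interval_mean W n m"
  have mean: "interval_mean V n m \<le> interval_mean W n m + (edge_mass W (card {n..m}) + edge_mass V (card {n..m}))"
    if "n \<le> m" for n m
  proof -
    let ?c = "of_nat (card {n..m}) :: ennreal"
    \<comment> \<open>Cancelling the length against the division in \<open>[0, \<infinity>]\<close>
      is valid only for a nonzero finite factor.\<close>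
    have c: "?c \<noteq> 0" "?c \<noteq> \<infinity>" using that by auto
    have "(\<Sum>l\<in>{n..m}. row_mass V l) \<le> (\<Sum>j\<in>{n..m}. column_mass W j) + ?c * edge_mass V (card {n..m})"
      using row_sum_le_column_sum[OF that, of V] by (simp add: col)
    also have "\<dots> \<le> ((\<Sum>l\<in>{n..m}. row_mass W l) + ?c * edge_mass W (card {n..m})) + ?c * edge_mass V (card {n..m})"
      by (intro add_right_mono column_sum_le_row_sum that)
    also have "\<dots> = (\<Sum>l\<in>{n..m}. row_mass W l) + (edge_mass W (card {n..m}) + edge_mass V (card {n..m})) * ?c"
      by (simp add: algebra_simps)
    finally have "interval_mean V n m
        \<le> ((\<Sum>l\<in>{n..m}. row_mass W l) + (edge_mass W (card {n..m}) + edge_mass V (card {n..m})) * ?c) / ?c"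
      unfolding interval_mean_eq_row_mass by (rule divide_right_mono_ennreal)
    also have "\<dots> = interval_mean W n m + (edge_mass W (card {n..m}) + edge_mass V (card {n..m}))"
      unfolding interval_mean_eq_row_mass add_divide_distrib_ennreal
      using c by (simp add: mult_divide_eq_ennreal)
    finally show ?thesis .
  qed
  have le: "?s V N \<le> ?s W N + (edge_mass W N + edge_mass V N)" if "N > 0" for N
  proof (rule SUP_least, clarify)
    fix n m :: int assume nm: "n \<le> m" "N \<le> card {n..m}"
    note mean[OF nm(1)]
    also have "interval_mean W n m + (edge_mass W (card {n..m}) + edge_mass V (card {n..m}))
        \<le> ?s W N + (edge_mass W N + edge_mass V N)"
      using nm that by (intro add_mono edge_mass_antimono SUP_upper2[of "(n, m)"]) auto
    finally show "interval_mean V n m \<le> ?s W N + (edge_mass W N + edge_mass V N)" .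
  qed
  have "(\<lambda>N. ?s W N + (edge_mass W N + edge_mass V N)) \<longlonglongrightarrow> mean_limsup W + (0 + 0)"
    by (intro tendsto_add mean_limsup_LIMSEQ edge_mass_tendsto_0 assms)
  then have "mean_limsup V \<le> mean_limsup W + (0 + 0)"
    by (rule LIMSEQ_le[OF mean_limsup_LIMSEQ]) (use le in \<open>auto intro!: exI[of _ 1] simp del: card_atLeastAtMost_int\<close>)
  then show ?thesis by simp
qed

text \<open>The diagonal suprema of a product are dominated by the convolution of those of the
  factors, and by Tonelli the convolution has total mass the product of the two masses. Needed
  because the edge estimate is applied to \<open>U \<circ> W\<close> itself.\<close>

lemma diag_sup_comp_summable:
  assumes U: "L2_operator U" and W: "L2_operator W"
    and "(\<integral>\<^sup>+k. diag_sup U k \<partial>count_space UNIV) < \<infinity>"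
    and "(\<integral>\<^sup>+k. diag_sup W k \<partial>count_space UNIV) < \<infinity>"
  shows "(\<integral>\<^sup>+k. diag_sup (U \<circ> W) k \<partial>count_space UNIV) < \<infinity>"
proof -
  have entry: "ennreal (cmod (matrix_entry V l j)) \<le> diag_sup V (l - j)" for V l j
    unfolding diag_sup_def by (rule SUP_upper2[of j]) auto
  have shift: "(\<integral>\<^sup>+i. f (i + j) \<partial>count_space UNIV) = (\<integral>\<^sup>+i. f i \<partial>count_space UNIV)"
    for f :: "int \<Rightarrow> ennreal" and j
    by (rule nn_integral_bij_count_space) (rule bij_betw_byWitness[of _ "\<lambda>k. k - j"], auto)
  have conv: "diag_sup (U \<circ> W) k \<le> (\<integral>\<^sup>+i. diag_sup U (k - i) * diag_sup W i \<partial>count_space UNIV)" for k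
    unfolding diag_sup_def[of "U \<circ> W"]
  proof (rule SUP_least)
    fix j
    have "ennreal (cmod (matrix_entry (U \<circ> W) (k + j) j))
        \<le> (\<integral>\<^sup>+i. ennreal (cmod (matrix_entry U (k + j) i)) * ennreal (cmod (matrix_entry W i j)) \<partial>count_space UNIV)"
      by (rule matrix_entry_comp_le[OF W U])
    \<comment> \<open>Moving the intermediate index by \<open>j\<close> puts the two entries on the
      diagonals \<open>k - i\<close> and \<open>i\<close>, which do not depend on
      \<open>j\<close>.\<close>
    also have "\<dots> = (\<integral>\<^sup>+i. ennreal (cmod (matrix_entry U (k + j) (i + j)))
        * ennreal (cmod (matrix_entry W (i + j) j)) \<partial>count_space UNIV)"
      by (rule shift[symmetric])
    also have "\<dots> \<le> (\<integral>\<^sup>+i. diag_sup U (k - i) * diag_sup W i \<partial>count_space UNIV)"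
      using entry[of U "k + j" "_ + j"] entry[of W "_ + j" j]
      by (intro nn_integral_mono mult_mono) simp_all
    finally show "ennreal (cmod (matrix_entry (U \<circ> W) (k + j) j))
        \<le> (\<integral>\<^sup>+i. diag_sup U (k - i) * diag_sup W i \<partial>count_space UNIV)" .
  qed
  have "(\<integral>\<^sup>+k. diag_sup (U \<circ> W) k \<partial>count_space UNIV)
      \<le> (\<integral>\<^sup>+k. \<integral>\<^sup>+i. diag_sup U (k - i) * diag_sup W i \<partial>count_space UNIV \<partial>count_space UNIV)"
    by (intro nn_integral_mono conv)
  also have "\<dots> = (\<integral>\<^sup>+i. \<integral>\<^sup>+k. diag_sup U (k - i) * diag_sup W i \<partial>count_space UNIV \<partial>count_space UNIV)"
    using nn_integral_fst_count_space[of "\<lambda>(k, i). diag_sup U (k - i) * diag_sup W i"]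
      nn_integral_snd_count_space[of "\<lambda>(k, i). diag_sup U (k - i) * diag_sup W i"] by simp
  also have "\<dots> = (\<integral>\<^sup>+i. (\<integral>\<^sup>+k. diag_sup U k \<partial>count_space UNIV) * diag_sup W i \<partial>count_space UNIV)"
    using shift[of "diag_sup U" "- _"] by (simp add: nn_integral_multc)
  also have "\<dots> = (\<integral>\<^sup>+k. diag_sup U k \<partial>count_space UNIV) * (\<integral>\<^sup>+i. diag_sup W i \<partial>count_space UNIV)"
    by (rule nn_integral_cmult) simp
  also have "\<dots> < \<infinity>" using assms by (simp add: ennreal_mult_less_top)
  finally show ?thesis .
qed

theorem proposition8p2:
  fixes W U :: L2_map
  assumes "W \<in> diagonal_type" and "U \<in> diagonal_type" and "unitary_operator U"
  shows "mean_limsup (W \<circ> U) = mean_limsup W \<and> mean_limsup W = mean_limsup (U \<circ> W)"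
proof
  have W: "L2_operator W" "(\<integral>\<^sup>+k. diag_sup W k \<partial>count_space UNIV) < \<infinity>"
    and U: "L2_operator U" "(\<integral>\<^sup>+k. diag_sup U k \<partial>count_space UNIV) < \<infinity>"
    using assms(1,2) by (auto simp: diagonal_type_def infsum_ennreal_eq_nn_integral)
  show "mean_limsup (W \<circ> U) = mean_limsup W"
    by (simp add: mean_limsup_def interval_mean_eq_row_mass row_mass_comp_unitary W assms(3))
  show "mean_limsup W = mean_limsup (U \<circ> W)"
    by (intro antisym mean_limsup_le_of_column_mass_eq diag_sup_comp_summable W U)
       (simp_all add: column_mass_unitary_comp W assms(3))
qed

end
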